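(* Let $m\geq 1$. There is an isomorphism of bigraded $\mathbf{Q}$-vector spaces $$A\simeq\mathrm{Sym}\left(\bigoplus_{i\geq 0}S^iB^L\right),$$ where $\mathrm{Sym}$ denotes the (ordinary) symmetric algebra.
   Context: Fix an integer $m\ge 1$. For $n\ge 0$ let $\Lambda_n$ be the set of integer sequences $\lambda=(0\leq\lambda_1\leq\ldots\leq\lambda_n)$, called partitions of length $l(\lambda)=n$ (zero parts are counted), and $\Lambda=\bigsqcup_{n\ge0}\Lambda_n$. Put $|\lambda|=\lambda_1+\ldots+\lambda_n$ and $\mathrm{wt}(\lambda)=(m-1)\binom{n}{2}-|\lambda|$. For $N\in\mathbf{N}$, $S^N\lambda=(\lambda_1+N,\ldots,\lambda_n+N)$. The union $\mu\cup\nu$ is the partition whose parts are all parts of $\mu$ and $\nu$ (with multiplicity), sorted in ascending order. $A$ is the $\mathbf{Q}$-vector space with basis $\Lambda$, with associative bilinear product $\mu*\nu=\mu\cup S^{(m-1)l(\mu)}\nu$, bigraded by placing $\lambda$ in bidegree $(l(\lambda),\mathrm{wt}(\lambda))$. $S$ also denotes the linear operator on $A$ induced by $\lambda\mapsto S^1\lambda$; $S^i V$ is the image of a subspace $V\subset A$ under $S^i$, with the bigrading as a subspace of $A$. $T_n\subset\Lambda_n$ is the set of $\lambda$ with $\lambda_i\leq(m-1)(i-1)$ for $i=1,\ldots,n$. For $n\ge1$, $T_n^0\subset T_n$ is the set of $\lambda\in T_n$ with $\lambda_i<(m-1)(i-1)$ for $i=2,\ldots,n$; $T^0=\bigsqcup_{n\ge1}T^0_n$.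 $T^0$ is totally ordered lexicographically (partitions viewed as words in the alphabet $\mathbf{N}$, a proper prefix being smaller), and words in the alphabet $T^0$ are ordered lexicographically with respect to this order. A nonempty word in the alphabet $T^0$ is called Lyndon if it is strictly bigger than all its proper cyclic shifts. $T^L$ is the set of all partitions $\lambda^1*\ldots*\lambda^k$ with $\lambda^1\ldots\lambda^k$ a Lyndon word in $T^0$, and $B^L\subset A$ is the span of $T^L$. *)

theory Defs
  imports
    Complex_Main
    "HOL-Library.Poly_Mapping"
    "HOL-Library.Multiset"
    "HOL-Library.List_Lexorder"
    "HOL-Library.Product_Plus"
    "HOL-Algebra.QuotRing"
begin

section \<open>Partitions\<close>

text \<open>
  Partitions are ascending lists of natural numbers; zero parts count towards the length.
  The \<open>i\<close>-th part of \<open>l\<close>, counted from 1, is \<open>l ! (i - 1)\<close>.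
\<close>

definition partitions :: "nat list set" where
  "partitions = {l. sorted l}"

definition wt :: "nat \<Rightarrow> nat list \<Rightarrow> int" where
  "wt m l = (int m - 1) * int (length l choose 2) - int (sum_list l)"

definition shift_part :: "nat \<Rightarrow> nat list \<Rightarrow> nat list" where
  "shift_part N l = map (\<lambda>x. x + N) l"

definition union_part :: "nat list \<Rightarrow> nat list \<Rightarrow> nat list" where
  "union_part \<mu> \<nu> = sort (\<mu> @ \<nu>)"

definition star_part :: "nat \<Rightarrow> nat list \<Rightarrow> nat list \<Rightarrow> nat list" where
  "star_part m \<mu> \<nu> = union_part \<mu> (shift_part ((m - 1) * length \<mu>) \<nu>)"

definition T :: "nat \<Rightarrow> nat \<Rightarrow> nat list set" where
  "T m n = {l \<in> partitions. length l = n \<and> (\<forall>i\<in>{1..n}. l ! (i - 1) \<le> (m - 1) * (i - 1))}"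

definition T0n :: "nat \<Rightarrow> nat \<Rightarrow> nat list set" where
  "T0n m n = {l \<in> T m n. \<forall>i\<in>{2..n}. l ! (i - 1) < (m - 1) * (i - 1)}"

definition T0 :: "nat \<Rightarrow> nat list set" where
  "T0 m = (\<Union>n\<in>{1..}. T0n m n)"

text \<open>
  On both levels (partitions as words over the naturals, words over \<open>T0\<close>) the order \<open><\<close>
  is the lexicographic order of \<open>List_Lexorder\<close>, for which a proper prefix is smaller.
  The convention is that a Lyndon word is bigger, not smaller, than its proper cyclic shifts.
\<close>

definition lyndon :: "nat list list \<Rightarrow> bool" where
  "lyndon w \<longleftrightarrow> w \<noteq> [] \<and> (\<forall>k\<in>{0<..<length w}. rotate k w < w)"

text \<open>The empty partition is the unit of the product, hence the base of the fold.\<close>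

definition TL :: "nat \<Rightarrow> nat list set" where
  "TL m = {foldr (star_part m) w [] | w. set w \<subseteq> T0 m \<and> lyndon w}"


section \<open>The bigraded space \<open>A\<close> and the subspaces \<open>S\<^sup>i B\<^sup>L\<close>\<close>

definition qscale :: "rat \<Rightarrow> ('b \<Rightarrow>\<^sub>0 rat) \<Rightarrow> ('b \<Rightarrow>\<^sub>0 rat)" where
  "qscale c p = Poly_Mapping.map ((*) c) p"

lemma lookup_qscale: "Poly_Mapping.lookup (qscale c p) k = c * Poly_Mapping.lookup p k"
  by (simp add: qscale_def Poly_Mapping.map.rep_eq when_def)

interpretation Q: vector_space "qscale :: rat \<Rightarrow> ('b \<Rightarrow>\<^sub>0 rat) \<Rightarrow> _"
  by unfold_locales
    (rule poly_mapping_eqI; simp add: lookup_qscale lookup_add algebra_simps)+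

definition basis :: "'b \<Rightarrow> ('b \<Rightarrow>\<^sub>0 rat)" where
  "basis b = Poly_Mapping.single b 1"

definition A :: "(nat list \<Rightarrow>\<^sub>0 rat) set" where
  "A = Q.span (basis ` partitions)"

definition A_comp :: "nat \<Rightarrow> nat \<times> int \<Rightarrow> (nat list \<Rightarrow>\<^sub>0 rat) set" where
  "A_comp m d = Q.span (basis ` {l \<in> partitions. (length l, wt m l) = d})"

definition shift_op :: "(nat list \<Rightarrow>\<^sub>0 rat) \<Rightarrow> (nat list \<Rightarrow>\<^sub>0 rat)" where
  "shift_op a = (\<Sum>l\<in>Poly_Mapping.keys a. qscale (Poly_Mapping.lookup a l) (basis (shift_part 1 l)))"

definition BL :: "nat \<Rightarrow> (nat list \<Rightarrow>\<^sub>0 rat) set" where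
  "BL m = Q.span (basis ` TL m)"

definition SBL :: "nat \<Rightarrow> nat \<Rightarrow> (nat list \<Rightarrow>\<^sub>0 rat) set" where
  "SBL m i = (shift_op ^^ i) ` BL m"

definition SBL_comp :: "nat \<Rightarrow> nat \<Rightarrow> nat \<times> int \<Rightarrow> (nat list \<Rightarrow>\<^sub>0 rat) set" where
  "SBL_comp m i d = SBL m i \<inter> A_comp m d"


section \<open>External direct sums\<close>

text \<open>
  Elements of the external direct sum of subspaces \<open>U i\<close> are the finitely supported
  families with \<open>i\<close>-th entry in \<open>U i\<close>; the homogeneous components are obtained by applying
  the same construction to the components of the summands.
\<close>

definition direct_sum :: "('i \<Rightarrow> 'v::zero set) \<Rightarrow> ('i \<Rightarrow>\<^sub>0 'v) set" where
  "direct_sum U = {f. \<forall>i. Poly_Mapping.lookup f i \<in> U i}"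

definition dscale :: "rat \<Rightarrow> ('i \<Rightarrow>\<^sub>0 ('b \<Rightarrow>\<^sub>0 rat)) \<Rightarrow> ('i \<Rightarrow>\<^sub>0 ('b \<Rightarrow>\<^sub>0 rat))" where
  "dscale c f = Poly_Mapping.map (qscale c) f"

lemma lookup_dscale: "Poly_Mapping.lookup (dscale c f) i = qscale c (Poly_Mapping.lookup f i)"
  by (simp add: dscale_def Poly_Mapping.map.rep_eq when_def)

interpretation D: vector_space "dscale :: rat \<Rightarrow> ('i \<Rightarrow>\<^sub>0 ('b \<Rightarrow>\<^sub>0 rat)) \<Rightarrow> _"
  by unfold_locales
    (rule poly_mapping_eqI;
     simp add: lookup_dscale lookup_add Q.scale_right_distrib Q.scale_left_distrib)+


definition SBL_sum :: "nat \<Rightarrow> (nat \<Rightarrow>\<^sub>0 (nat list \<Rightarrow>\<^sub>0 rat)) set" where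
  "SBL_sum m = direct_sum (SBL m)"

definition SBL_sum_comp :: "nat \<Rightarrow> nat \<times> int \<Rightarrow> (nat \<Rightarrow>\<^sub>0 (nat list \<Rightarrow>\<^sub>0 rat)) set" where
  "SBL_sum_comp m d = direct_sum (\<lambda>i. SBL_comp m i d)"


section \<open>Symmetric algebras\<close>

text \<open>
  Let \<open>V\<close> be a subspace of a rational vector space with scalar multiplication \<open>sc\<close>.
  The symmetric algebra of \<open>V\<close> is the commutative algebra generated by the
  elements of \<open>V\<close> subject to the linear relations that hold in \<open>V\<close>: the polynomial ring
  with one variable \<open>sym_var v\<close> for every vector \<open>v \<in> V\<close> (monomials are multisets of
  vectors), modulo the ideal generated by \<open>x\<^bsub>u+v\<^esub> - x\<^bsub>u\<^esub> - x\<^bsub>v\<^esub>\<close> and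
  \<open>x\<^bsub>c v\<^esub> - c x\<^bsub>v\<^esub>\<close>.
\<close>

definition sym_var :: "'v \<Rightarrow> ('v multiset \<Rightarrow>\<^sub>0 rat)" where
  "sym_var v = Poly_Mapping.single {#v#} 1"

definition sym_const :: "rat \<Rightarrow> ('v multiset \<Rightarrow>\<^sub>0 rat)" where
  "sym_const c = Poly_Mapping.single {#} c"

definition poly_on :: "'v set \<Rightarrow> ('v multiset \<Rightarrow>\<^sub>0 rat) ring" where
  "poly_on V = \<lparr>carrier = {p. \<forall>M\<in>Poly_Mapping.keys p. set_mset M \<subseteq> V},
     mult = (*), one = 1, zero = 0, add = (+)\<rparr>"

definition sym_rels ::
  "(rat \<Rightarrow> 'v \<Rightarrow> 'v::ab_group_add) \<Rightarrow> 'v set \<Rightarrow> ('v multiset \<Rightarrow>\<^sub>0 rat) set" where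
  "sym_rels sc V =
     {sym_var (u + v) - sym_var u - sym_var v | u v. u \<in> V \<and> v \<in> V} \<union>
     {sym_var (sc c v) - sym_const c * sym_var v | c v. v \<in> V}"

definition sym_ideal ::
  "(rat \<Rightarrow> 'v \<Rightarrow> 'v::ab_group_add) \<Rightarrow> 'v set \<Rightarrow> ('v multiset \<Rightarrow>\<^sub>0 rat) set" where
  "sym_ideal sc V = Idl\<^bsub>poly_on V\<^esub> (sym_rels sc V)"

definition Sym ::
  "(rat \<Rightarrow> 'v \<Rightarrow> 'v::ab_group_add) \<Rightarrow> 'v set \<Rightarrow> ('v multiset \<Rightarrow>\<^sub>0 rat) set ring" where
  "Sym sc V = poly_on V Quot sym_ideal sc V"

definition sym_class ::
  "(rat \<Rightarrow> 'v \<Rightarrow> 'v::ab_group_add) \<Rightarrow> 'v set \<Rightarrow> ('v multiset \<Rightarrow>\<^sub>0 rat) \<Rightarrow> ('v multiset \<Rightarrow>\<^sub>0 rat) set"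
  where "sym_class sc V p = sym_ideal sc V +>\<^bsub>poly_on V\<^esub> p"

definition sym_scale ::
  "(rat \<Rightarrow> 'v \<Rightarrow> 'v::ab_group_add) \<Rightarrow> 'v set \<Rightarrow> rat \<Rightarrow>
   ('v multiset \<Rightarrow>\<^sub>0 rat) set \<Rightarrow> ('v multiset \<Rightarrow>\<^sub>0 rat) set" where
  "sym_scale sc V c X = sym_class sc V (sym_const c) \<otimes>\<^bsub>Sym sc V\<^esub> X"

text \<open>
  If \<open>V\<close> is graded with components \<open>grd e\<close>, the component of degree \<open>d\<close> of its symmetric
  algebra is spanned by the products \<open>v\<^sub>1 \<cdots> v\<^sub>k\<close> of homogeneous vectors \<open>v\<^sub>j\<close> whose
  degrees add up to \<open>d\<close>. A product is recorded as the multiset \<open>N\<close> of the pairs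
  (degree of \<open>v\<^sub>j\<close>, \<open>v\<^sub>j\<close>), since the zero vector lies in every component.
\<close>

definition sym_monomials ::
  "('d::comm_monoid_add \<Rightarrow> 'v set) \<Rightarrow> 'd \<Rightarrow> ('v multiset \<Rightarrow>\<^sub>0 rat) set" where
  "sym_monomials grd d =
     {basis (image_mset snd N) | N.
        (\<forall>(e, v)\<in>#N. v \<in> grd e) \<and> (\<Sum>(e, v)\<in>#N. e) = d}"

definition Sym_comp ::
  "(rat \<Rightarrow> 'v \<Rightarrow> 'v::ab_group_add) \<Rightarrow> 'v set \<Rightarrow> ('d::comm_monoid_add \<Rightarrow> 'v set) \<Rightarrow> 'd \<Rightarrow>
   ('v multiset \<Rightarrow>\<^sub>0 rat) set set" where
  "Sym_comp sc V grd d = sym_class sc V ` Q.span (sym_monomials grd d)"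

lemma poly_on_simps:
  "p \<in> carrier (poly_on V) \<longleftrightarrow> (\<forall>M\<in>Poly_Mapping.keys p. set_mset M \<subseteq> V)"
  "p \<otimes>\<^bsub>poly_on V\<^esub> q = p * q" "\<one>\<^bsub>poly_on V\<^esub> = 1"
  "p \<oplus>\<^bsub>poly_on V\<^esub> q = p + q" "\<zero>\<^bsub>poly_on V\<^esub> = 0"
  by (simp_all add: poly_on_def)

lemma poly_on_add:
  "p \<in> carrier (poly_on V) \<Longrightarrow> q \<in> carrier (poly_on V) \<Longrightarrow> p + q \<in> carrier (poly_on V)"
  unfolding poly_on_simps using keys_add[of p q] by blast

lemma poly_on_diff:
  "p \<in> carrier (poly_on V) \<Longrightarrow> q \<in> carrier (poly_on V) \<Longrightarrow> p - q \<in> carrier (poly_on V)"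
  unfolding poly_on_simps using keys_diff[of p q] by blast

lemma poly_on_mult:
  assumes "p \<in> carrier (poly_on V)" "q \<in> carrier (poly_on V)"
  shows "p * q \<in> carrier (poly_on V)"
  unfolding poly_on_simps
proof
  fix M assume "M \<in> Poly_Mapping.keys (p * q)"
  then obtain M1 M2 where "M = M1 + M2" "M1 \<in> Poly_Mapping.keys p" "M2 \<in> Poly_Mapping.keys q"
    using keys_mult[of p q] by blast
  then show "set_mset M \<subseteq> V"
    using assms by (simp add: poly_on_simps)
qed

lemma poly_on_0: "0 \<in> carrier (poly_on V)"
  by (simp add: poly_on_simps)

lemma poly_on_1: "1 \<in> carrier (poly_on V)"
  by (simp add: poly_on_simps)

lemma cring_poly_on: "cring (poly_on V)"
proof (rule cringI)
  show "abelian_group (poly_on V)"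
  proof (rule abelian_groupI)
    fix x assume "x \<in> carrier (poly_on V)"
    then have "0 - x \<in> carrier (poly_on V)"
      by (intro poly_on_diff poly_on_0)
    then show "\<exists>y\<in>carrier (poly_on V). y \<oplus>\<^bsub>poly_on V\<^esub> x = \<zero>\<^bsub>poly_on V\<^esub>"
      by (rule bexI[rotated]) (simp add: poly_on_simps(2-))
  qed (simp_all add: poly_on_simps(2-) poly_on_add poly_on_0 ac_simps)
  show "Group.comm_monoid (poly_on V)"
    by (rule comm_monoidI) (simp_all add: poly_on_simps(2-) poly_on_mult poly_on_1 ac_simps)
qed (simp add: poly_on_simps(2-) distrib_right)

lemma sym_rels_carrier:
  assumes "\<And>u v. u \<in> V \<Longrightarrow> v \<in> V \<Longrightarrow> u + v \<in> V" "\<And>c v. v \<in> V \<Longrightarrow> sc c v \<in> V"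
  shows "sym_rels sc V \<subseteq> carrier (poly_on V)"
proof -
  have var: "sym_var v \<in> carrier (poly_on V)" if "v \<in> V" for v
    using that by (simp add: poly_on_simps sym_var_def)
  have const: "sym_const c \<in> carrier (poly_on V)" for c
    by (simp add: poly_on_simps sym_const_def)
  show ?thesis
    unfolding sym_rels_def
    by (auto intro!: poly_on_diff poly_on_mult var const assms)
qed

lemma cring_Sym:
  assumes "\<And>u v. u \<in> V \<Longrightarrow> v \<in> V \<Longrightarrow> u + v \<in> V" "\<And>c v. v \<in> V \<Longrightarrow> sc c v \<in> V"
  shows "cring (Sym sc V)"
proof -
  interpret cring "poly_on V" by (rule cring_poly_on)
  have "ideal (sym_ideal sc V) (poly_on V)"
    unfolding sym_ideal_def by (intro genideal_ideal sym_rels_carrier assms)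
  then show ?thesis
    unfolding Sym_def by (intro ideal.quotient_is_cring cring_poly_on)
qed


section \<open>Isomorphisms of bigraded rational vector spaces\<close>

text \<open>
  A bigraded space is passed as carrier, addition, scalar multiplication and family of
  homogeneous components.
\<close>

definition bigraded_iso ::
  "'a set \<Rightarrow> ('a \<Rightarrow> 'a \<Rightarrow> 'a) \<Rightarrow> (rat \<Rightarrow> 'a \<Rightarrow> 'a) \<Rightarrow> (nat \<times> int \<Rightarrow> 'a set) \<Rightarrow>
   'b set \<Rightarrow> ('b \<Rightarrow> 'b \<Rightarrow> 'b) \<Rightarrow> (rat \<Rightarrow> 'b \<Rightarrow> 'b) \<Rightarrow> (nat \<times> int \<Rightarrow> 'b set) \<Rightarrow>
   ('a \<Rightarrow> 'b) \<Rightarrow> bool" where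
  "bigraded_iso X addX scX compX Y addY scY compY \<phi> \<longleftrightarrow>
     bij_betw \<phi> X Y \<and>
     (\<forall>x\<in>X. \<forall>y\<in>X. \<phi> (addX x y) = addY (\<phi> x) (\<phi> y)) \<and>
     (\<forall>c. \<forall>x\<in>X. \<phi> (scX c x) = scY c (\<phi> x)) \<and>
     (\<forall>d. \<phi> ` compX d = compY d)"

end

theory Submission
  imports Defs "HOL-Library.Dual_Ordered_Lattice"
begin

text \<open>
  Every partition is a concatenation \<open>\<tau>\<^sub>0 * S \<tau>\<^sub>1 * S\<^sup>2 \<tau>\<^sub>2 * \<dots>\<close> with all \<open>\<tau>\<^sub>i\<close> in \<open>\<Union>n. T m n\<close>,
  uniquely up to trailing empty factors: \<open>\<tau>\<^sub>0\<close> is the longest prefix below the staircase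
  \<open>(m - 1) (i - 1)\<close>, and the first part beyond it exceeds the staircase by at least 1. Cutting a
  member of \<open>T m n\<close> where it touches the staircase identifies these partitions with words over
  \<open>T0 m\<close>, and by the Chen-Fox-Lyndon theorem such words correspond to multisets of Lyndon words.
  Hence partitions correspond, degree by degree, to multisets of pairs \<open>(i, t)\<close> with \<open>t\<close> in
  \<open>TL m\<close>, that is, to the monomials in the basis \<open>S\<^sup>i t\<close> of \<open>\<Oplus>i. S\<^sup>i B\<^sup>L\<close>. These monomials form a
  basis of the symmetric algebra: sending a vector to its coordinate form identifies the
  symmetric algebra with a polynomial ring.
\<close>

section \<open>Lyndon factorization\<close>

lemma list_less_append_left [simp]: "xs @ ys < xs @ zs \<longleftrightarrow> ys < zs"
  for xs :: "'a::linorder list"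
  by (induction xs) auto

lemma list_le_append_right: "xs \<le> xs @ ys" for xs :: "'a::linorder list"
  by (induction xs) auto

text \<open>Neither word is a prefix of the other, so the inequality is decided at the first
  differing letter and survives any appended words.\<close>

lemma list_less_not_prefix:
  assumes "xs < ys" "\<nexists>zs. ys = xs @ zs"
  shows "xs @ us < ys @ vs"
  using assms by (induction xs ys rule: list_induct2') auto

lemma list_less_same_length_append:
  "length xs = length ys \<Longrightarrow> xs < ys \<Longrightarrow> xs @ us < ys @ vs"
  for xs ys :: "'a::linorder list"
  by (induction xs ys rule: list_induct2) auto

section \<open>Lyndon words by suffixes and by rotations\<close>

text \<open>The usual orientation, with minimal words, is the opposite of \<open>lyndon\<close>.
  Suffixes replace rotations because they behave better under factorization.\<close>

definition lyndon_suffix :: "'a::linorder list \<Rightarrow> bool" where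
  "lyndon_suffix w \<longleftrightarrow> w \<noteq> [] \<and> (\<forall>u v. w = u @ v \<longrightarrow> u \<noteq> [] \<longrightarrow> v \<noteq> [] \<longrightarrow> w < v)"

text \<open>Suppose a proper suffix \<open>v\<close> is smaller than \<open>w\<close>. If
  \<open>v\<close> is not a prefix of \<open>w\<close>, then already the rotation
  \<open>v @ u\<close> is smaller than \<open>w\<close>. If \<open>w = v @ u'\<close>, then
  \<open>w < v @ u\<close> gives \<open>u' < u\<close>, hence \<open>u' @ v < u @ v = w\<close> by
  equality of lengths, against the hypothesis for the rotation \<open>u' @ v\<close>.\<close>

lemma lyndon_suffixI:
  assumes "w \<noteq> []" and rot: "\<And>u v. w = u @ v \<Longrightarrow> u \<noteq> [] \<Longrightarrow> v \<noteq> [] \<Longrightarrow> w < v @ u"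
  shows "lyndon_suffix w"
  unfolding lyndon_suffix_def
proof (intro conjI allI impI)
  fix u v assume w: "w = u @ v" and ne: "u \<noteq> []" "v \<noteq> []"
  show "w < v"
  proof (rule ccontr)
    assume "\<not> w < v"
    moreover have "w \<noteq> v" using w ne by auto
    ultimately have vw: "v < w" by simp
    show False
    proof (cases "\<exists>u'. w = v @ u'")
      case False
      then have "v @ u < w @ []" using vw by (intro list_less_not_prefix) auto
      then show False using rot[OF w ne] by simp
    next
      case True
      then obtain u' where u': "w = v @ u'" by blast
      then have len: "length u' = length u" using w
        by (metis add.commute add_left_cancel length_append)
      have "u' < u" using rot[OF w ne] u' by simp
      then have "u' @ v < w" using list_less_same_length_append[OF len] w by metis
      moreover have "w < u' @ v" using rot[OF u'] ne len by (metis length_0_conv)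
      ultimately show False by simp
    qed
  qed
qed (fact assms(1))

text \<open>A proper suffix is shorter than \<open>w\<close>, so \<open>w < v\<close> does not come
  from a prefix and persists when \<open>u\<close> is appended.\<close>

lemma lyndon_suffixD:
  assumes "lyndon_suffix w" and w: "w = u @ v" and ne: "u \<noteq> []" "v \<noteq> []"
  shows "w < v @ u"
proof -
  have "w < v" using assms by (auto simp: lyndon_suffix_def)
  moreover have "\<nexists>z. v = w @ z"
  proof
    assume "\<exists>z. v = w @ z"
    then have "length w \<le> length v" by auto
    then show False using w ne by simp
  qed
  ultimately have "w @ [] < v @ u" by (rule list_less_not_prefix)
  then show ?thesis by simp
qed

lemma lyndon_suffix_iff_rotate:
  "lyndon_suffix w \<longleftrightarrow> w \<noteq> [] \<and> (\<forall>k\<in>{0<..<length w}. w < rotate k w)"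
proof safe
  fix k assume "lyndon_suffix w" and k: "k \<in> {0<..<length w}"
  then have "w < drop k w @ take k w"
    by (intro lyndon_suffixD[of w "take k w" "drop k w"]) auto
  then show "w < rotate k w" using k by (simp add: rotate_drop_take)
next
  assume "w \<noteq> []" and *: "\<forall>k\<in>{0<..<length w}. w < rotate k w"
  show "lyndon_suffix w"
  proof (rule lyndon_suffixI[OF \<open>w \<noteq> []\<close>])
    fix u v assume "w = u @ v" "u \<noteq> []" "v \<noteq> []"
    then show "w < v @ u" using *[rule_format, of "length u"] by (simp add: rotate_append)
  qed
qed (simp add: lyndon_suffix_def)

section \<open>The Chen-Fox-Lyndon factorization\<close>

text \<open>
  The last factor is the least nonempty suffix, so it is determined by the whole word.
\<close>

lemma lyndon_last_le_suffix:
  assumes "\<forall>l\<in>set (ls @ [l]). lyndon_suffix l" "sorted_wrt (\<ge>) (ls @ [l])"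
    and "concat (ls @ [l]) = u @ s" "s \<noteq> []"
  shows "l \<le> s"
  using assms
proof (induction ls arbitrary: u)
  case Nil
  then show ?case by (cases "u = []") (auto simp: lyndon_suffix_def intro: less_imp_le)
next
  case (Cons a ls)
  have la: "l \<le> a" using Cons.prems(2) by simp
  have eq: "a @ concat (ls @ [l]) = u @ s" using Cons.prems(3) by simp
  \<comment> \<open>Either \<open>s\<close> starts inside the first factor and so begins with a
    nonempty suffix \<open>z\<close> of it, or it is a suffix of the remaining product.\<close>
  then consider (1) z where "a = u @ z" "s = z @ concat (ls @ [l])" "z \<noteq> []"
    | (2) z where "u = a @ z" "concat (ls @ [l]) = z @ s"
    unfolding append_eq_append_conv2 by (metis append_Nil append_Nil2)
  then show ?case
  proof cases
    case 1
    have "a \<le> z"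
      using Cons.prems(1) 1 by (cases "u = []") (auto simp: lyndon_suffix_def intro: less_imp_le)
    also have "z \<le> s" unfolding 1 by (rule list_le_append_right)
    finally show ?thesis using la by simp
  next
    case 2
    then show ?thesis using Cons.IH[of z] Cons.prems by simp
  qed
qed

text \<open>Each of the two last factors is a nonempty suffix of the common word, so each is at most
  the other. Cancel it and continue.\<close>

lemma lyndon_factorization_unique:
  assumes "\<forall>l\<in>set ls. lyndon_suffix l" "sorted_wrt (\<ge>) ls"
    and "\<forall>l\<in>set ls'. lyndon_suffix l" "sorted_wrt (\<ge>) ls'"
    and "concat ls = concat ls'"
  shows "ls = ls'"
  using assms
proof (induction ls arbitrary: ls' rule: rev_induct)
  case Nil
  then show ?case by (cases ls') (auto simp: lyndon_suffix_def)
next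
  case (snoc l ls)
  have "l \<noteq> []" using snoc.prems(1) by (simp add: lyndon_suffix_def)
  then have "ls' \<noteq> []" using snoc.prems(5) by auto
  then obtain k ks where ks: "ls' = ks @ [k]" by (metis rev_exhaust)
  have "k \<noteq> []" using snoc.prems(3) ks by (simp add: lyndon_suffix_def)
  have eq: "concat (ls @ [l]) = concat ks @ k" "concat (ks @ [k]) = concat ls @ l"
    using snoc.prems(5) ks by simp_all
  have "l \<le> k" using lyndon_last_le_suffix[OF snoc.prems(1,2) eq(1) \<open>k \<noteq> []\<close>] .
  moreover have "k \<le> l"
    using lyndon_last_le_suffix[OF _ _ eq(2) \<open>l \<noteq> []\<close>] snoc.prems(3,4) ks by simp
  ultimately have "l = k" by simp
  then have "concat ls = concat ks" using eq by simp
  then have "ls = ks" using snoc.prems ks by (intro snoc.IH) (auto simp: sorted_wrt_append)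
  then show ?case using ks \<open>l = k\<close> by simp
qed

text \<open>Split off the least nonempty suffix \<open>s\<close>. It is Lyndon because its own
  suffixes are suffixes of \<open>w\<close>, and the rest factors by induction.\<close>

lemma lyndon_factorization_exists:
  "\<exists>ls. (\<forall>l\<in>set ls. lyndon_suffix l) \<and> sorted_wrt (\<ge>) ls \<and> concat ls = w"
proof (induction w rule: length_induct)
  case (1 w)
  show ?case
  proof (cases "w = []")
    case False
    define F where "F = {v. v \<noteq> [] \<and> (\<exists>u. w = u @ v)}"
    have "F \<subseteq> (\<lambda>n. drop n w) ` {..length w}"
    proof
      fix v assume "v \<in> F"
      then obtain u where "w = u @ v" by (auto simp: F_def)
      then have "v = drop (length u) w" "length u \<le> length w" by auto
      then show "v \<in> (\<lambda>n. drop n w) ` {..length w}" by blast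
    qed
    then have fin: "finite F" by (rule finite_subset) simp
    have "F \<noteq> {}" using False unfolding F_def by blast
    define s where "s = Min F"
    have "s \<in> F" using fin \<open>F \<noteq> {}\<close> by (simp add: s_def)
    then obtain w' where w': "w = w' @ s" and "s \<noteq> []" by (auto simp: F_def)
    have s_le: "s \<le> v" if "w = u @ v" "v \<noteq> []" for u v
      using fin that by (auto simp: s_def F_def)
    have s_lyn: "lyndon_suffix s"
      unfolding lyndon_suffix_def
    proof (intro conjI allI impI)
      fix u v assume "s = u @ v" "u \<noteq> []" "v \<noteq> []"
      then show "s < v" using s_le[of "w' @ u" v] w' by (auto simp: order_less_le)
    qed (fact \<open>s \<noteq> []\<close>)
    obtain ls where ls: "\<forall>l\<in>set ls. lyndon_suffix l" "sorted_wrt (\<ge>) ls" "concat ls = w'"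
      using 1 w' \<open>s \<noteq> []\<close> by (metis length_append length_greater_0_conv less_add_same_cancel1)
    \<comment> \<open>If the last factor \<open>k\<close> of the rest were below \<open>s\<close>,
      minimality of \<open>s\<close> against the suffix \<open>k @ s\<close> would force
      \<open>s = k @ s'\<close>. Then \<open>s' \<le> s\<close> by cancelling \<open>k\<close>,
      while \<open>s < s'\<close> because \<open>s\<close> is Lyndon.\<close>
    have ge: "s \<le> l" if l: "l \<in> set ls" for l
    proof -
      obtain ks k where ks: "ls = ks @ [k]" using l by (metis empty_iff empty_set rev_exhaust)
      have "s \<le> k"
      proof (rule ccontr)
        assume "\<not> s \<le> k"
        then have ks_less: "k < s" by simp
        have "k \<noteq> []" using ls(1) ks by (simp add: lyndon_suffix_def)
        have "s \<le> k @ s" using s_le[of "concat ks" "k @ s"] w' ls(3) ks \<open>s \<noteq> []\<close> by simp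
        moreover have "\<not> s \<le> k @ s" if "\<nexists>s'. s = k @ s'"
          using list_less_not_prefix[OF ks_less that, of s "[]"] by simp
        ultimately obtain s' where s': "s = k @ s'" by blast
        with ks_less have "s' \<noteq> []" by auto
        have "s < s'" using s' \<open>s' \<noteq> []\<close> \<open>k \<noteq> []\<close> s_lyn by (auto simp: lyndon_suffix_def)
        moreover have "s' \<le> s" using \<open>s \<le> k @ s\<close> s' by (metis leD leI list_less_append_left)
        ultimately show False by simp
      qed
      also have "k \<le> l" using ls(2) l ks by (auto simp: sorted_wrt_append)
      finally show ?thesis .
    qed
    show ?thesis
      using ls s_lyn ge w' by (intro exI[of _ "ls @ [s]"]) (auto simp: sorted_wrt_append)
  qed (auto intro: exI[of _ "[]"])
qed

text \<open>Since the factors of a Lyndon factorization are non-increasing, their multiset already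
  records it.\<close>

definition lyndon_concat :: "'a::linorder list multiset \<Rightarrow> 'a list" where
  "lyndon_concat M = concat (rev (sorted_list_of_multiset M))"

lemma set_lyndon_concat: "set (lyndon_concat M) = (\<Union>l\<in>set_mset M. set l)"
  by (simp add: lyndon_concat_def)

text \<open>Surjectivity is the existence and injectivity the uniqueness of the
  factorization.\<close>

lemma bij_betw_lyndon_concat:
  "bij_betw lyndon_concat {M. \<forall>l\<in>#M. lyndon_suffix l \<and> set l \<subseteq> X} (lists X)"
proof (rule bij_betw_imageI)
  show "inj_on lyndon_concat {M. \<forall>l\<in>#M. lyndon_suffix l \<and> set l \<subseteq> X}"
  proof (rule inj_onI)
    fix M N :: "'a list multiset"
    assume "M \<in> {M. \<forall>l\<in>#M. lyndon_suffix l \<and> set l \<subseteq> X}"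
      "N \<in> {M. \<forall>l\<in>#M. lyndon_suffix l \<and> set l \<subseteq> X}" "lyndon_concat M = lyndon_concat N"
    then have "rev (sorted_list_of_multiset M) = rev (sorted_list_of_multiset N)"
      by (intro lyndon_factorization_unique)
        (auto simp: lyndon_concat_def sorted_wrt_rev sorted_sorted_list_of_multiset)
    then show "M = N" by (metis mset_sorted_list_of_multiset rev_rev_ident)
  qed
  show "lyndon_concat ` {M. \<forall>l\<in>#M. lyndon_suffix l \<and> set l \<subseteq> X} = lists X"
  proof safe
    fix w assume "\<forall>x\<in>set w. x \<in> X"
    obtain ls where ls: "\<forall>l\<in>set ls. lyndon_suffix l" "sorted_wrt (\<ge>) ls" "concat ls = w"
      using lyndon_factorization_exists by blast
    have "sorted (rev ls)" using ls(2) by (simp add: sorted_wrt_rev)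
    then have "sorted_list_of_multiset (mset ls) = rev ls"
      by (metis mset_rev sorted_list_of_multiset_mset sorted_sort_id)
    then have "lyndon_concat (mset ls) = w" using ls(3) by (simp add: lyndon_concat_def)
    moreover have "mset ls \<in> {M. \<forall>l\<in>#M. lyndon_suffix l \<and> set l \<subseteq> X}"
      using ls \<open>\<forall>x\<in>set w. x \<in> X\<close> by auto
    ultimately show "w \<in> lyndon_concat ` {M. \<forall>l\<in>#M. lyndon_suffix l \<and> set l \<subseteq> X}"
      by blast
  qed (auto simp: set_lyndon_concat)
qed

section \<open>Passage to the order in which Lyndon words are maximal\<close>

text \<open>
  The words of \<^const>\<open>lyndon\<close> are maximal, not minimal, among their rotations. Reversing the
  order of the letters exchanges the two, because rotations have equal length and so the prefix
  convention plays no role.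
\<close>

instance dual :: (linorder) linorder
  by standard (simp add: dual_less_eq_iff linear)

lemma map_dual_less_iff:
  "length xs = length ys \<Longrightarrow> map dual xs < map dual ys \<longleftrightarrow> ys < xs"
  for xs ys :: "'a::linorder list"
  by (induction xs ys rule: list_induct2) auto

lemma lyndon_iff_dual: "lyndon w \<longleftrightarrow> lyndon_suffix (map dual w)"
  unfolding lyndon_def lyndon_suffix_iff_rotate rotate_map by (simp add: map_dual_less_iff)

section \<open>Partitions as multisets of shifted Lyndon partitions\<close>

lemma length_shift_part [simp]: "length (shift_part N l) = length l"
  by (simp add: shift_part_def)

lemma nth_shift_part: "i < length l \<Longrightarrow> shift_part N l ! i = l ! i + N"
  by (simp add: shift_part_def)

lemma shift_part_Nil [simp]: "shift_part N [] = []"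
  by (simp add: shift_part_def)

lemma shift_part_0 [simp]: "shift_part 0 l = l"
  by (simp add: shift_part_def)

lemma shift_part_append [simp]: "shift_part N (k @ l) = shift_part N k @ shift_part N l"
  by (simp add: shift_part_def)

lemma shift_part_shift_part: "shift_part N (shift_part M l) = shift_part (N + M) l"
  by (simp add: shift_part_def comp_def ac_simps)

lemma sum_list_shift_part: "sum_list (shift_part N l) = sum_list l + N * length l"
  by (induction l) (auto simp: shift_part_def)

lemma sorted_shift_part [simp]: "sorted (shift_part N l) \<longleftrightarrow> sorted l"
  by (simp add: shift_part_def sorted_map)

lemma inj_shift_part: "inj (shift_part N)"
  unfolding shift_part_def by (intro inj_mapI injI) simp

lemma shift_part_eq_iff [simp]: "shift_part N k = shift_part N l \<longleftrightarrow> k = l"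
  using inj_shift_part by (auto dest: injD)

text \<open>By sortedness all parts from position \<open>n\<close> on are at least \<open>c\<close>,
  so the truncated subtraction of \<open>c\<close> loses nothing. If \<open>n\<close> lies beyond
  the end, the bound is vacuous and \<open>r\<close> is empty. Both ways of cutting a partition at
  the staircase rest on this.\<close>

lemma drop_eq_shift_part:
  assumes "sorted l" "n < length l \<Longrightarrow> c \<le> l ! n"
  obtains r where "sorted r" "drop n l = shift_part c r"
proof -
  define r where "r = map (\<lambda>x. x - c) (drop n l)"
  have ge: "c \<le> x" if x: "x \<in> set (drop n l)" for x
  proof -
    obtain i where i: "i < length (drop n l)" "x = drop n l ! i"
      using x by (metis in_set_conv_nth)
    then have "c \<le> l ! n" using assms(2) by simp
    also have "\<dots> \<le> x" using i assms(1) by (auto intro: sorted_nth_mono)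
    finally show ?thesis .
  qed
  have "sorted (drop n l)" using assms(1) by (rule sorted_wrt_drop)
  then have "sorted r" unfolding r_def sorted_map
    by (rule sorted_wrt_mono_rel[rotated]) (auto intro: diff_le_mono)
  moreover have "drop n l = shift_part c r"
    using ge by (auto simp: r_def shift_part_def comp_def intro!: map_idI[symmetric])
  ultimately show ?thesis by (rule that)
qed

definition deg :: "nat \<Rightarrow> nat list \<Rightarrow> nat \<times> int" where
  "deg m l = (length l, wt m l)"

lemma int_choose_two_add: "int ((a + b) choose 2) = int (a choose 2) + int (b choose 2) + int a * int b"
proof (induction b)
  case (Suc b)
  then show ?case by (simp add: numeral_2_eq_2 algebra_simps)
qed (simp add: numeral_2_eq_2)

text \<open>The offset \<open>(m - 1) * length k\<close> lowers the weight by exactly the cross term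
  that \<open>int_choose_two_add\<close> produces. The offset \<open>c\<close> reappears in the
  second summand. The hypothesis makes the truncated \<open>m - 1\<close> agree with
  \<open>int m - 1\<close>.\<close>

lemma deg_shift_append:
  assumes "m \<ge> 1"
  shows "deg m (shift_part i (k @ shift_part ((m - 1) * length k + c) l)) =
    deg m (shift_part i k) + deg m (shift_part (i + c) l)"
proof -
  obtain n where "m = Suc n" using assms by (cases m) auto
  then show ?thesis
    by (simp add: deg_def wt_def sum_list_shift_part int_choose_two_add algebra_simps)
qed

section \<open>Partitions below the staircase as words over \<open>T0 m\<close>\<close>

text \<open>All \<open>T m n\<close> at once, with positions counted from 0.\<close>

definition T_all :: "nat \<Rightarrow> nat list set" where
  "T_all m = {l. sorted l \<and> (\<forall>i<length l. l ! i \<le> (m - 1) * i)}"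

lemma ball_one_to_iff: "(\<forall>i\<in>{1..n}. P (i - 1)) \<longleftrightarrow> (\<forall>i<n. P i)" for n :: nat
proof safe
  fix i assume *: "\<forall>i\<in>{1..n}. P (i - 1)" and "i < n"
  then show "P i" using *[rule_format, of "Suc i"] by simp
qed auto

lemma ball_two_to_iff: "(\<forall>i\<in>{2..n}. P (i - 1)) \<longleftrightarrow> (\<forall>i<n. 0 < i \<longrightarrow> P i)" for n :: nat
proof safe
  fix i assume *: "\<forall>i\<in>{2..n}. P (i - 1)" and "i < n" "0 < i"
  then show "P i" using *[rule_format, of "Suc i"] by simp
qed auto

lemma T_iff: "l \<in> T m n \<longleftrightarrow> l \<in> T_all m \<and> length l = n"
  using ball_one_to_iff[of n "\<lambda>i. l ! i \<le> (m - 1) * i"]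
  by (auto simp: T_def T_all_def partitions_def)

lemma T0_iff:
  "l \<in> T0 m \<longleftrightarrow> l \<in> T_all m \<and> l \<noteq> [] \<and> (\<forall>i<length l. 0 < i \<longrightarrow> l ! i < (m - 1) * i)"
  using ball_two_to_iff[of "length l" "\<lambda>i. l ! i < (m - 1) * i"]
  by (auto simp: T0_def T0n_def T_iff Suc_le_eq)

lemma T_all_sorted: "l \<in> T_all m \<Longrightarrow> sorted l"
  by (simp add: T_all_def)

lemma T_all_nth: "l \<in> T_all m \<Longrightarrow> i < length l \<Longrightarrow> l ! i \<le> (m - 1) * i"
  by (simp add: T_all_def)

text \<open>Every part of \<open>k\<close> is at most the height of the staircase at position
  \<open>length k\<close>, and the shift lifts all of \<open>l\<close> to at least that
  height.\<close>

lemma sorted_append_shift_part: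
  assumes "k \<in> T_all m" "sorted l"
  shows "sorted (k @ shift_part ((m - 1) * length k + c) l)"
proof -
  have "x \<le> y" if "x \<in> set k" and y: "y \<in> set (shift_part ((m - 1) * length k + c) l)" for x y
  proof -
    obtain i where "i < length k" "x = k ! i" using \<open>x \<in> set k\<close> by (metis in_set_conv_nth)
    then have "x \<le> (m - 1) * i" using assms by (simp add: T_all_def)
    also have "\<dots> \<le> (m - 1) * length k" using \<open>i < length k\<close> by simp
    also have "\<dots> \<le> y" using y by (auto simp: shift_part_def)
    finally show ?thesis .
  qed
  then show ?thesis using assms by (auto simp: sorted_append T_all_def)
qed

text \<open>The concatenation is already sorted. With products turned into concatenations, factors
  can be recovered as prefixes.\<close>

lemma star_part_eq_append:
  assumes "k \<in> T_all m" "sorted l"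
  shows "star_part m k l = k @ shift_part ((m - 1) * length k) l"
  using sorted_append_shift_part[OF assms, of 0]
  by (simp add: star_part_def union_part_def sorted_sort_id)

lemma append_shift_part_in_T_all:
  assumes "k \<in> T_all m" "l \<in> T_all m"
  shows "k @ shift_part ((m - 1) * length k) l \<in> T_all m"
  unfolding T_all_def
proof (intro CollectI conjI allI impI)
  show "sorted (k @ shift_part ((m - 1) * length k) l)"
    using sorted_append_shift_part[OF assms(1), of l 0] T_all_sorted[OF assms(2)] by simp
  fix i assume i: "i < length (k @ shift_part ((m - 1) * length k) l)"
  show "(k @ shift_part ((m - 1) * length k) l) ! i \<le> (m - 1) * i"
  proof (cases "i < length k")
    case False
    then have "l ! (i - length k) \<le> (m - 1) * (i - length k)"
      using i assms(2) by (intro T_all_nth) auto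
    moreover have "(m - 1) * (i - length k) + (m - 1) * length k = (m - 1) * i"
      using False by (simp flip: add_mult_distrib2)
    ultimately show ?thesis using False i by (simp add: nth_append nth_shift_part)
  next
    case True
    then show ?thesis using T_all_nth[OF assms(1) True] by (simp add: nth_append)
  qed
qed

definition star_word :: "nat \<Rightarrow> nat list list \<Rightarrow> nat list" where
  "star_word m w = foldr (star_part m) w []"

lemma star_word_Nil [simp]: "star_word m [] = []"
  by (simp add: star_word_def)

lemma star_word_in_T_all: "set w \<subseteq> T0 m \<Longrightarrow> star_word m w \<in> T_all m"
proof (induction w)
  case (Cons a w)
  have a: "a \<in> T_all m" using Cons.prems by (simp add: T0_iff)
  then show ?case
    using Cons append_shift_part_in_T_all[OF a, of "star_word m w"]
      star_part_eq_append[OF a, of "star_word m w"] by (auto simp: star_word_def T_all_sorted)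
qed (simp add: T_all_def)

lemma star_word_Cons:
  assumes "a \<in> T0 m" "set w \<subseteq> T0 m"
  shows "star_word m (a # w) = a @ shift_part ((m - 1) * length a) (star_word m w)"
  using assms star_part_eq_append[of a m "star_word m w"] star_word_in_T_all[OF assms(2)]
  by (simp add: star_word_def T0_iff T_all_sorted)

lemma deg_star_word:
  assumes "m \<ge> 1" "set w \<subseteq> T0 m"
  shows "deg m (shift_part i (star_word m w)) = (\<Sum>a\<leftarrow>w. deg m (shift_part i a))"
  using assms(2)
proof (induction w)
  case Nil
  then show ?case by (simp add: deg_def wt_def zero_prod_def numeral_2_eq_2)
next
  case (Cons a w)
  then show ?case using deg_shift_append[OF assms(1), of i a 0 "star_word m w"]
    by (simp add: star_word_Cons)
qed

text \<open>If \<open>b\<close> were longer than \<open>a\<close>, its part at position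
  \<open>length a\<close> would be the first part of the shifted tail, which is not below the
  staircase, while later parts of a letter are strictly below it. Used in both directions, this
  recovers the first letter of a word from the product.\<close>

lemma T0_prefix_length_le:
  assumes "a @ shift_part ((m - 1) * length a) k = b @ l" "a \<in> T0 m" "b \<in> T0 m"
  shows "length b \<le> length a"
proof (rule ccontr)
  assume "\<not> length b \<le> length a"
  then have less: "length a < length b" by simp
  have "length a + length k = length b + length l"
    using arg_cong[OF assms(1), of length] by simp
  then have "k \<noteq> []" using less by auto
  have "b ! length a = (b @ l) ! length a" using less by (simp add: nth_append)
  also have "\<dots> = k ! 0 + (m - 1) * length a"
    unfolding assms(1)[symmetric] using \<open>k \<noteq> []\<close> by (simp add: nth_append nth_shift_part)
  finally have "(m - 1) * length a \<le> b ! length a" by simp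
  moreover have "b ! length a < (m - 1) * length a"
    using assms(2,3) less by (auto simp: T0_iff)
  ultimately show False by simp
qed

lemma star_word_inj:
  assumes "set v \<subseteq> T0 m" "set w \<subseteq> T0 m" "star_word m v = star_word m w"
  shows "v = w"
  using assms
proof (induction v w rule: list_induct2')
  case (2 x xs)
  then show ?case by (simp add: star_word_Cons) (simp add: T0_iff)
next
  case (3 y ys)
  then show ?case by (simp add: star_word_Cons) (simp add: T0_iff)
next
  case (4 x xs y ys)
  have mem: "x \<in> T0 m" "y \<in> T0 m" "set xs \<subseteq> T0 m" "set ys \<subseteq> T0 m" using 4 by auto
  have eq: "x @ shift_part ((m - 1) * length x) (star_word m xs) =
      y @ shift_part ((m - 1) * length y) (star_word m ys)"
    using 4 mem by (simp add: star_word_Cons)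
  have "length x = length y"
    using T0_prefix_length_le[OF eq] T0_prefix_length_le[OF eq[symmetric]] mem by simp
  then have "x = y" "star_word m xs = star_word m ys" using eq by auto
  then show ?case using 4 mem by simp
qed simp

text \<open>Cut \<open>l\<close> at the first positive position where it touches the staircase. The
  prefix is a letter, and the rest, shifted down, is again below the staircase.\<close>

lemma star_word_surj:
  assumes "l \<in> T_all m"
  shows "\<exists>w. set w \<subseteq> T0 m \<and> star_word m w = l"
  using assms
proof (induction "length l" arbitrary: l rule: less_induct)
  case less
  show ?case
  proof (cases "l = []")
    case True
    then show ?thesis by (intro exI[of _ "[]"]) simp
  next
    case False
    \<comment> \<open>\<open>0 < n\<close> makes the letter nonempty. If \<open>l\<close> never
      touches the staircase at a positive position, the implication yields
      \<open>n = length l\<close>, and \<open>l\<close> is a single letter.\<close>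
    define n where "n = (LEAST n. 0 < n \<and> (n < length l \<longrightarrow> l ! n = (m - 1) * n))"
    have n: "0 < n \<and> (n < length l \<longrightarrow> l ! n = (m - 1) * n)"
      unfolding n_def by (rule LeastI[of _ "length l"]) (use False in simp)
    have before: "l ! i < (m - 1) * i" if "0 < i" "i < n" "i < length l" for i
      using not_less_Least[of i] that T_all_nth[OF less.prems, of i]
      unfolding n_def[symmetric] by (metis (mono_tags, lifting) le_neq_implies_less n_def not_less_Least)
    have "n \<le> length l" unfolding n_def by (rule Least_le) (use False in simp)
    have a: "take n l \<in> T0 m"
      using less.prems before n False sorted_wrt_take by (auto simp: T0_iff T_all_def)
    obtain r where r: "sorted r" "drop n l = shift_part ((m - 1) * n) r"
      using drop_eq_shift_part[OF T_all_sorted[OF less.prems], of n "(m - 1) * n"] n by auto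
    have len: "length r = length l - n" using arg_cong[OF r(2), of length] by simp
    have "r \<in> T_all m"
      unfolding T_all_def
    proof (intro CollectI conjI allI impI)
      fix i assume i: "i < length r"
      then have "r ! i + (m - 1) * n = drop n l ! i" unfolding r by (simp add: nth_shift_part)
      also have "\<dots> \<le> (m - 1) * (n + i)"
        using i len \<open>n \<le> length l\<close> T_all_nth[OF less.prems, of "n + i"] by simp
      finally show "r ! i \<le> (m - 1) * i" by (simp add: distrib_left)
    qed (fact r)
    moreover have "length r < length l" using len n False by simp
    ultimately obtain w where w: "set w \<subseteq> T0 m" "star_word m w = r" using less.hyps by blast
    have "star_word m (take n l # w) = take n l @ shift_part ((m - 1) * n) r"
      using w a \<open>n \<le> length l\<close> by (simp add: star_word_Cons min_absorb2)
    also have "\<dots> = l" unfolding r(2)[symmetric] by simp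
    finally show ?thesis using w a by (intro exI[of _ "take n l # w"]) simp
  qed
qed

lemma bij_betw_star_word: "bij_betw (star_word m) (lists (T0 m)) (T_all m)"
proof (rule bij_betw_imageI)
  show "inj_on (star_word m) (lists (T0 m))"
    by (rule inj_onI) (use star_word_inj in blast)
  show "star_word m ` lists (T0 m) = T_all m"
    using star_word_in_T_all star_word_surj by (fastforce simp: lists_eq_set image_iff)
qed

section \<open>Multisets of Lyndon partitions\<close>

lemma bij_betw_image_mset:
  assumes "bij_betw f X Y"
  shows "bij_betw (image_mset f) {M. set_mset M \<subseteq> X} {M. set_mset M \<subseteq> Y}"
proof (rule bij_betw_byWitness[where f' = "image_mset (inv_into X f)"])
  show "\<forall>M\<in>{M. set_mset M \<subseteq> X}. image_mset (inv_into X f) (image_mset f M) = M"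
    using bij_betw_inv_into_left[OF assms]
    by (auto simp: multiset.map_comp intro!: multiset.map_ident_strong)
  show "\<forall>M\<in>{M. set_mset M \<subseteq> Y}. image_mset f (image_mset (inv_into X f) M) = M"
    using bij_betw_inv_into_right[OF assms]
    by (auto simp: multiset.map_comp intro!: multiset.map_ident_strong)
qed (use bij_betwE[OF assms] bij_betwE[OF bij_betw_inv_into[OF assms]] in \<open>auto simp: subset_eq\<close>)

definition lyndon_words :: "nat \<Rightarrow> nat list list set" where
  "lyndon_words m = {w \<in> lists (T0 m). lyndon w}"

lemma bij_betw_star_word_TL: "bij_betw (star_word m) (lyndon_words m) (TL m)"
proof (rule bij_betw_imageI)
  show "inj_on (star_word m) (lyndon_words m)"
    by (rule inj_on_subset[OF bij_betw_imp_inj_on[OF bij_betw_star_word]])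
      (auto simp: lyndon_words_def)
qed (auto simp: lyndon_words_def TL_def star_word_def lists_eq_set)

lemma bij_betw_lyndon_words:
  "bij_betw (map dual) (lyndon_words m) {l. lyndon_suffix l \<and> set l \<subseteq> dual ` T0 m}"
proof (rule bij_betw_byWitness[where f' = "map undual"])
  show "map undual ` {l. lyndon_suffix l \<and> set l \<subseteq> dual ` T0 m} \<subseteq> lyndon_words m"
    by (fastforce simp: lyndon_words_def lyndon_iff_dual comp_def)
qed (auto simp: lyndon_words_def lyndon_iff_dual comp_def)

text \<open>Each member of \<open>M\<close> is replaced by its Lyndon word, the words are
  concatenated in the order of the Lyndon factorization, formed in the dual alphabet, and the result
  is multiplied out. It is thus a composite of bijections.\<close>

definition star_lyndon :: "nat \<Rightarrow> nat list multiset \<Rightarrow> nat list" where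
  "star_lyndon m M = star_word m (map undual (lyndon_concat
     (image_mset (map dual) (image_mset (inv_into (lyndon_words m) (star_word m)) M))))"

lemma bij_betw_star_lyndon: "bij_betw (star_lyndon m) {M. set_mset M \<subseteq> TL m} (T_all m)"
proof -
  have "bij_betw (map undual) (lists (dual ` T0 m)) (lists (T0 m))"
    by (rule bij_betw_byWitness[where f' = "map dual"]) (force simp: comp_def)+
  moreover have "bij_betw lyndon_concat
      {M. set_mset M \<subseteq> {l. lyndon_suffix l \<and> set l \<subseteq> dual ` T0 m}} (lists (dual ` T0 m))"
    using bij_betw_lyndon_concat[of "dual ` T0 m"] by (simp add: subset_eq Ball_def)
  ultimately have "bij_betw (star_word m \<circ> map undual \<circ> lyndon_concat \<circ> image_mset (map dual) \<circ>
      image_mset (inv_into (lyndon_words m) (star_word m))) {M. set_mset M \<subseteq> TL m} (T_all m)"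
    by (intro bij_betw_trans[OF bij_betw_image_mset[OF bij_betw_inv_into[OF bij_betw_star_word_TL]]]
        bij_betw_trans[OF bij_betw_image_mset[OF bij_betw_lyndon_words]]
        bij_betw_trans[OF _ bij_betw_star_word] bij_betw_trans) (simp_all add: comp_assoc)
  then show ?thesis by (simp add: star_lyndon_def[abs_def] comp_def)
qed

lemma sum_list_lyndon_concat:
  "(\<Sum>a\<leftarrow>lyndon_concat M. f a) = (\<Sum>l\<in>#M. \<Sum>a\<leftarrow>l. f a)"
  for f :: "_ \<Rightarrow> 'b::comm_monoid_add"
proof -
  have "(\<Sum>a\<leftarrow>concat ls. f a) = (\<Sum>l\<in>#mset ls. \<Sum>a\<leftarrow>l. f a)" for ls
    by (induction ls) auto
  then show ?thesis by (simp add: lyndon_concat_def)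
qed

text \<open>The degree of a product, under a common shift \<open>i\<close>, is the sum over its
  letters in \<open>T0 m\<close>, and concatenating the Lyndon words only regroups the
  letters.\<close>

lemma deg_star_lyndon:
  assumes "m \<ge> 1" and M: "set_mset M \<subseteq> TL m"
  shows "deg m (shift_part i (star_lyndon m M)) = (\<Sum>t\<in>#M. deg m (shift_part i t))"
proof -
  define f where "f = inv_into (lyndon_words m) (star_word m)"
  have f: "f t \<in> lyndon_words m" "star_word m (f t) = t" if "t \<in> TL m" for t
    using that bij_betw_inv_into[OF bij_betw_star_word_TL, of m]
      bij_betw_inv_into_right[OF bij_betw_star_word_TL, of t m]
    by (auto simp: f_def dest: bij_betwE)
  have "set (map undual (lyndon_concat (image_mset (map dual) (image_mset f M)))) \<subseteq> T0 m"
    using f M by (fastforce simp: set_lyndon_concat lyndon_words_def)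
  then have "deg m (shift_part i (star_lyndon m M)) =
      (\<Sum>t\<in>#M. \<Sum>a\<leftarrow>f t. deg m (shift_part i a))"
    by (simp add: star_lyndon_def deg_star_word[OF assms(1)] comp_def sum_list_lyndon_concat
        multiset.map_comp flip: f_def)
  also have "\<dots> = (\<Sum>t\<in>#M. deg m (shift_part i t))"
  proof (intro arg_cong[of _ _ sum_mset] image_mset_cong)
    fix t assume "t \<in># M"
    then have "f t \<in> lyndon_words m" "star_word m (f t) = t" using f M by auto
    then show "(\<Sum>a\<leftarrow>f t. deg m (shift_part i a)) = deg m (shift_part i t)"
      using deg_star_word[OF assms(1), of "f t" i] by (simp add: lyndon_words_def lists_eq_set)
  qed
  finally show ?thesis .
qed

section \<open>Splitting off the longest prefix below the staircase\<close>

text \<open>For \<open>t\<close> below the staircase and sorted \<open>r\<close> this is the product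
  of \<open>t\<close> with \<open>S r\<close>. The extra 1 puts the first part of the tail strictly
  above the staircase, which marks where \<open>t\<close> ends.\<close>

definition join :: "nat \<Rightarrow> nat list \<Rightarrow> nat list \<Rightarrow> nat list" where
  "join m t r = t @ shift_part ((m - 1) * length t + 1) r"

lemma join_Nil [simp]: "join m [] [] = []"
  by (simp add: join_def)

lemma sorted_join: "t \<in> T_all m \<Longrightarrow> sorted r \<Longrightarrow> sorted (join m t r)"
  unfolding join_def by (rule sorted_append_shift_part)

lemma deg_join:
  "m \<ge> 1 \<Longrightarrow> deg m (shift_part i (join m t r)) =
    deg m (shift_part i t) + deg m (shift_part (Suc i) r)"
  using deg_shift_append[of m i t 1 r] by (simp add: join_def)

text \<open>A longer \<open>t\<close> would contain the first part of the tail after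
  \<open>s\<close>, which exceeds the staircase at its position by at least 1.\<close>

lemma join_prefix_length_le:
  assumes "join m s q = t @ r" "t \<in> T_all m"
  shows "length t \<le> length s"
proof (rule ccontr)
  assume "\<not> length t \<le> length s"
  then have less: "length s < length t" by simp
  have "length s + length q = length t + length r"
    using arg_cong[OF assms(1), of length] by (simp add: join_def)
  then have "q \<noteq> []" using less by auto
  have "t ! length s = (t @ r) ! length s" using less by (simp add: nth_append)
  also have "\<dots> = q ! 0 + ((m - 1) * length s + 1)"
    unfolding assms(1)[symmetric] join_def using \<open>q \<noteq> []\<close> by (simp add: nth_append nth_shift_part)
  finally show False using T_all_nth[OF assms(2) less] by simp
qed

lemma join_inj:
  assumes eq: "join m s q = join m t r" and mem: "s \<in> T_all m" "t \<in> T_all m"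
  shows "s = t \<and> q = r"
proof -
  have "length t \<le> length s"
    using join_prefix_length_le[OF _ mem(2)] eq by (metis join_def)
  moreover have "length s \<le> length t"
    using join_prefix_length_le[OF _ mem(1)] eq by (metis join_def)
  ultimately show ?thesis using eq by (auto simp: join_def)
qed

lemma join_surj:
  assumes "sorted l"
  obtains t r where "t \<in> T_all m" "sorted r" "l = join m t r"
proof -
  \<comment> \<open>The first position strictly above the staircase, or \<open>length l\<close> if
    there is none. In contrast to the cut into letters it may be 0, and then \<open>t\<close> is
    empty.\<close>
  define n where "n = (LEAST n. n < length l \<longrightarrow> (m - 1) * n < l ! n)"
  have n: "n < length l \<longrightarrow> (m - 1) * n < l ! n"
    unfolding n_def by (rule LeastI[of _ "length l"]) simp
  have before: "i < length l \<and> l ! i \<le> (m - 1) * i" if "i < n" for i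
    using not_less_Least[of i] that unfolding n_def by (metis (mono_tags, lifting) not_less)
  have "n \<le> length l" unfolding n_def by (rule Least_le) simp
  obtain r where r: "sorted r" "drop n l = shift_part ((m - 1) * n + 1) r"
    using drop_eq_shift_part[OF assms, of n "(m - 1) * n + 1"] n
    by (metis Suc_eq_plus1 Suc_leI)
  have "take n l \<in> T_all m" using assms before by (auto simp: T_all_def sorted_wrt_take)
  moreover have "l = join m (take n l) r"
    using \<open>n \<le> length l\<close> append_take_drop_id[of n l, symmetric]
    unfolding r(2) by (simp add: join_def min_absorb2)
  ultimately show ?thesis using r(1) that by blast
qed

section \<open>Assembling a partition level by level\<close>

text \<open>A pair \<open>(i, t)\<close> stands for the factor \<open>S\<^sup>i t\<close>, so level
  \<open>i\<close> collects the partitions to be shifted \<open>i\<close> times.\<close>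

definition level :: "nat \<Rightarrow> (nat \<times> 'a) multiset \<Rightarrow> 'a multiset" where
  "level i N = image_mset snd {#x \<in># N. fst x = i#}"

lemma level_add: "level i (M + N) = level i M + level i N"
  by (simp add: level_def)

lemma level_image_Pair: "level j (image_mset (Pair i) M) = (if i = j then M else {#})"
  by (induction M) (auto simp: level_def)

lemma set_mset_level: "set_mset (level i N) = {t. (i, t) \<in># N}"
  by (force simp: level_def)

lemma level_eq_empty: "i \<notin> fst ` set_mset N \<Longrightarrow> level i N = {#}"
  by (force simp: set_mset_level simp flip: set_mset_eq_empty_iff)

lemma multiset_eq_levelI:
  assumes "\<And>i. level i M = level i N"
  shows "M = N"
proof -
  have *: "{#x \<in># N. fst x = i#} = image_mset (Pair i) (level i N)" for i and N :: "(nat \<times> 'a) multiset"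
    by (induction N) (auto simp: level_def)
  have "{#x \<in># M. fst x = i#} = {#x \<in># N. fst x = i#}" for i
    unfolding * assms ..
  then have "count {#x \<in># M. fst x = fst y#} y = count {#x \<in># N. fst x = fst y#} y" for y by simp
  then show ?thesis by (intro multiset_eqI) simp
qed

lemma sum_mset_levels:
  fixes f :: "nat \<times> 'a \<Rightarrow> 'b::comm_monoid_add"
  assumes "fst ` set_mset N \<subseteq> {..<k}"
  shows "(\<Sum>x\<in>#N. f x) = (\<Sum>j<k. \<Sum>t\<in>#level j N. f (j, t))"
  using assms
proof (induction N)
  case (add x N)
  have "(\<Sum>j<k. \<Sum>t\<in>#level j (add_mset x N). f (j, t)) =
      (\<Sum>j<k. (if fst x = j then f x else 0) + (\<Sum>t\<in>#level j N. f (j, t)))"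
    by (intro sum.cong refl) (auto simp: level_def)
  also have "\<dots> = f x + (\<Sum>j<k. \<Sum>t\<in>#level j N. f (j, t))"
    using add.prems by (simp add: sum.distrib)
  finally show ?case using add by simp
qed (simp add: level_def)

text \<open>Multiplies out the levels \<open>i, ..., i + k - 1\<close>. Every nested
  \<open>join\<close> shifts the whole remaining tail once, so level \<open>j\<close> ends up
  shifted \<open>j - i\<close> times on top of the offsets of the product.\<close>

primrec build :: "nat \<Rightarrow> nat \<Rightarrow> nat \<Rightarrow> (nat \<times> nat list) multiset \<Rightarrow> nat list" where
  "build m 0 i N = []"
| "build m (Suc k) i N = join m (star_lyndon m (level i N)) (build m k (Suc i) N)"

lemma star_lyndon_empty [simp]: "star_lyndon m {#} = []"
  by (simp add: star_lyndon_def lyndon_concat_def)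

lemma star_lyndon_level_in_T_all:
  assumes "set_mset N \<subseteq> UNIV \<times> TL m"
  shows "star_lyndon m (level i N) \<in> T_all m"
proof -
  have "level i N \<in> {M. set_mset M \<subseteq> TL m}" using assms by (auto simp: set_mset_level)
  then show ?thesis using bij_betw_star_lyndon[of m] by (auto dest: bij_betwE)
qed

lemma sorted_build: "set_mset N \<subseteq> UNIV \<times> TL m \<Longrightarrow> sorted (build m k i N)"
  by (induction k arbitrary: i) (auto intro!: sorted_join star_lyndon_level_in_T_all)

lemma build_cong:
  "(\<And>j. j \<ge> i \<Longrightarrow> level j M = level j N) \<Longrightarrow> build m k i M = build m k i N"
  by (induction k arbitrary: i) auto

text \<open>\<open>join_inj\<close> peels off one level at a time, and \<open>star_lyndon\<close> is
  injective on each.\<close>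

lemma build_eqD:
  assumes "set_mset M \<subseteq> UNIV \<times> TL m" "set_mset N \<subseteq> UNIV \<times> TL m"
    and "build m k i M = build m k i N" "i \<le> j" "j < i + k"
  shows "level j M = level j N"
  using assms(3-)
proof (induction k arbitrary: i)
  case (Suc k)
  have *: "star_lyndon m (level i M) = star_lyndon m (level i N)"
    "build m k (Suc i) M = build m k (Suc i) N"
    using Suc.prems(1) join_inj[OF _ star_lyndon_level_in_T_all[OF assms(1)]
      star_lyndon_level_in_T_all[OF assms(2)]] by auto
  show ?case
  proof (cases "j = i")
    case True
    then show ?thesis
      using inj_onD[OF bij_betw_imp_inj_on[OF bij_betw_star_lyndon] *(1)] assms(1,2)
      by (auto simp: set_mset_level)
  next
    case False
    then show ?thesis using Suc.IH[OF *(2)] Suc.prems by simp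
  qed
qed simp

lemma build_eq_Nil: "(\<And>j. j \<ge> i \<Longrightarrow> level j N = {#}) \<Longrightarrow> build m k i N = []"
  by (induction k arbitrary: i) auto

text \<open>Trailing empty levels contribute only \<open>join m [] [] = []\<close>, so any number of
  levels that covers the support gives the same partition.\<close>

lemma build_extend:
  assumes "k \<le> k'" "\<And>j. j \<ge> i + k \<Longrightarrow> level j N = {#}"
  shows "build m k' i N = build m k i N"
  using assms
proof (induction k arbitrary: i k')
  case 0
  then show ?case by (simp add: build_eq_Nil)
next
  case (Suc k)
  obtain l where "k' = Suc l" "k \<le> l" using Suc.prems(1) by (cases k') auto
  then show ?case using Suc.IH[of l "Suc i"] Suc.prems(2) by simp
qed

lemma build_surj:
  assumes "sorted l"
  shows "\<exists>k N. set_mset N \<subseteq> {i..<i + k} \<times> TL m \<and> build m k i N = l"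
  using assms
\<comment> \<open>The length alone does not decrease when \<open>t\<close> is empty, but then every
  part of the tail drops by 1, so the sum does.\<close>
proof (induction "length l + sum_list l" arbitrary: l i rule: less_induct)
  case less
  show ?case
  proof (cases "l = []")
    case True
    then show ?thesis by (intro exI[of _ 0] exI[of _ "{#}"]) simp
  next
    case False
    obtain t r where t: "t \<in> T_all m" and r: "sorted r" and l: "l = join m t r"
      using join_surj[OF less.prems] .
    have "length r + sum_list r < length l + sum_list l"
    proof -
      have "length l + sum_list l = length t + length r + sum_list t + sum_list r
          + (m - 1) * length t * length r + length r"
        by (simp add: l join_def sum_list_shift_part algebra_simps)
      moreover have "length t + length r > 0" using False by (auto simp: l join_def)
      ultimately show ?thesis by linarith
    qed
    then obtain k N where N: "set_mset N \<subseteq> {Suc i..<Suc i + k} \<times> TL m"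
        and build: "build m k (Suc i) N = r"
      using less.hyps r by blast
    have "t \<in> star_lyndon m ` {M. set_mset M \<subseteq> TL m}"
      using t bij_betw_imp_surj_on[OF bij_betw_star_lyndon[of m]] by simp
    then obtain M where M: "set_mset M \<subseteq> TL m" "star_lyndon m M = t" by auto
    define N' where "N' = image_mset (Pair i) M + N"
    have "level i N = {#}" using N by (intro level_eq_empty) auto
    then have "level i N' = M" by (simp add: N'_def level_add level_image_Pair)
    moreover have "build m k (Suc i) N' = build m k (Suc i) N"
      by (rule build_cong) (simp add: N'_def level_add level_image_Pair)
    ultimately have "build m (Suc k) i N' = l" using build M l by simp
    moreover have "set_mset N' \<subseteq> {i..<i + Suc k} \<times> TL m" using N M by (auto simp: N'_def)
    ultimately show ?thesis by blast
  qed
qed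

lemma deg_Nil [simp]: "deg m [] = 0"
  by (simp add: deg_def wt_def zero_prod_def numeral_2_eq_2)

lemma deg_build:
  assumes "m \<ge> 1" "set_mset N \<subseteq> UNIV \<times> TL m"
  shows "deg m (shift_part i (build m k i N)) =
    (\<Sum>j=i..<i + k. \<Sum>t\<in>#level j N. deg m (shift_part j t))"
proof (induction k arbitrary: i)
  case (Suc k)
  have "set_mset (level i N) \<subseteq> TL m" using assms(2) by (auto simp: set_mset_level)
  then show ?case
    using Suc.IH[of "Suc i"]
    by (simp add: deg_join[OF assms(1)] deg_star_lyndon[OF assms(1)] sum.atLeast_Suc_lessThan
        del: sum.op_ivl_Suc)
qed simp

text \<open>A strict bound on the levels in use. The inserted 0 gives \<open>Max\<close> a value on
  the empty multiset.\<close>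

definition height :: "(nat \<times> 'a) multiset \<Rightarrow> nat" where
  "height N = Suc (Max (insert 0 (fst ` set_mset N)))"

lemma fst_less_height: "fst ` set_mset N \<subseteq> {..<height N}"
proof
  fix i assume "i \<in> fst ` set_mset N"
  then have "i \<le> Max (insert 0 (fst ` set_mset N))" by (intro Max_ge) auto
  then show "i \<in> {..<height N}" by (simp add: height_def)
qed

definition assemble :: "nat \<Rightarrow> (nat \<times> nat list) multiset \<Rightarrow> nat list" where
  "assemble m N = build m (height N) 0 N"

lemma build_eq_assemble:
  assumes "height N \<le> k \<or> fst ` set_mset N \<subseteq> {..<k}"
  shows "build m k 0 N = assemble m N"
proof -
  have *: "build m (max k (height N)) 0 N = build m k' 0 N"
    if "k' \<le> max k (height N)" "fst ` set_mset N \<subseteq> {..<k'}" for k'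
    using that by (intro build_extend level_eq_empty) auto
  have "fst ` set_mset N \<subseteq> {..<k}" using assms fst_less_height[of N] by auto
  then show ?thesis
    using *[of k] *[of "height N"] fst_less_height[of N] by (simp add: assemble_def)
qed

lemma bij_betw_assemble:
  "bij_betw (assemble m) {N. set_mset N \<subseteq> UNIV \<times> TL m} partitions"
proof (rule bij_betw_imageI)
  show "inj_on (assemble m) {N. set_mset N \<subseteq> UNIV \<times> TL m}"
  proof (rule inj_onI, unfold mem_Collect_eq)
    fix M N assume mem: "set_mset M \<subseteq> UNIV \<times> TL m" "set_mset N \<subseteq> UNIV \<times> TL m"
      and eq: "assemble m M = assemble m N"
    \<comment> \<open>The two partitions may be built with different numbers of levels; a common
      bound makes them comparable.\<close>
    define k where "k = max (height M) (height N)"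
    have "build m k 0 M = build m k 0 N"
      using eq by (simp add: k_def build_eq_assemble)
    then have less: "level j M = level j N" if "j < k" for j
      using build_eqD[OF mem] that by simp
    have "level j M = level j N" for j
    proof (cases "j < k")
      case False
      then have "j \<notin> fst ` set_mset M" "j \<notin> fst ` set_mset N"
        using fst_less_height[of M] fst_less_height[of N] by (auto simp: k_def)
      then show ?thesis by (simp add: level_eq_empty)
    qed (fact less)
    then show "M = N" by (rule multiset_eq_levelI)
  qed
  show "assemble m ` {N. set_mset N \<subseteq> UNIV \<times> TL m} = partitions"
  proof safe
    fix l assume "l \<in> partitions"
    then obtain k N where N: "set_mset N \<subseteq> {0..<k} \<times> TL m" and "build m k 0 N = l"
      using build_surj[of l 0 m] by (auto simp: partitions_def)
    moreover have "fst ` set_mset N \<subseteq> {..<k}" using N by auto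
    ultimately have "assemble m N = l" by (simp add: build_eq_assemble)
    then show "l \<in> assemble m ` {N. set_mset N \<subseteq> UNIV \<times> TL m}" using N by blast
  qed (auto simp: assemble_def partitions_def sorted_build)
qed

lemma deg_assemble:
  assumes "m \<ge> 1" "set_mset N \<subseteq> UNIV \<times> TL m"
  shows "deg m (assemble m N) = (\<Sum>(i, t)\<in>#N. deg m (shift_part i t))"
  using deg_build[OF assms, of 0 "height N"]
    sum_mset_levels[OF fst_less_height, of "\<lambda>(i, t). deg m (shift_part i t)" N]
  by (simp add: assemble_def atLeast0LessThan)

text \<open>Labels of a basis of the external direct sum: the first component names the summand, the
  second a basis partition in it.\<close>

definition gens :: "nat \<Rightarrow> (nat \<times> nat list) set" where
  "gens m = (SIGMA i:UNIV. shift_part i ` TL m)"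

text \<open>Invert \<open>assemble\<close> and carry out the shift recorded in each pair. The latter
  is injective because the tag \<open>i\<close> is kept.\<close>

lemma partitions_multisets_bij:
  assumes "m \<ge> 1"
  obtains K where "bij_betw K partitions {N. set_mset N \<subseteq> gens m}"
    and "\<And>l. l \<in> partitions \<Longrightarrow> (\<Sum>(i, t)\<in>#K l. deg m t) = deg m l"
proof -
  define h where "h = (\<lambda>(i, t). (i, shift_part i t))"
  have "bij_betw h (UNIV \<times> TL m) (gens m)"
    by (rule bij_betw_imageI) (auto simp: inj_on_def h_def gens_def image_iff)
  note h = bij_betw_image_mset[OF this]
  define g where "g = inv_into {N. set_mset N \<subseteq> UNIV \<times> TL m} (assemble m)"
  have g: "bij_betw g partitions {N. set_mset N \<subseteq> UNIV \<times> TL m}"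
    unfolding g_def by (rule bij_betw_inv_into[OF bij_betw_assemble])
  show ?thesis
  proof (rule that[of "image_mset h \<circ> g"])
    show "bij_betw (image_mset h \<circ> g) partitions {N. set_mset N \<subseteq> gens m}"
      using g h by (rule bij_betw_trans)
    fix l assume l: "l \<in> partitions"
    then have "set_mset (g l) \<subseteq> UNIV \<times> TL m" using g by (auto dest: bij_betwE)
    then have "deg m (assemble m (g l)) = (\<Sum>(i, t)\<in>#g l. deg m (shift_part i t))"
      by (rule deg_assemble[OF assms])
    moreover have "assemble m (g l) = l"
      unfolding g_def by (rule bij_betw_inv_into_right[OF bij_betw_assemble l])
    ultimately show "(\<Sum>(i, t)\<in>#(image_mset h \<circ> g) l. deg m t) = deg m l"
      by (simp add: h_def multiset.map_comp comp_def case_prod_unfold)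
  qed
qed

section \<open>A basis of the symmetric algebra\<close>

definition linext :: "('a \<Rightarrow> ('b \<Rightarrow>\<^sub>0 rat)) \<Rightarrow> ('a \<Rightarrow>\<^sub>0 rat) \<Rightarrow> ('b \<Rightarrow>\<^sub>0 rat)" where
  "linext g p = (\<Sum>k\<in>Poly_Mapping.keys p. qscale (Poly_Mapping.lookup p k) (g k))"

lemma linext_superset:
  assumes "finite K" "Poly_Mapping.keys p \<subseteq> K"
  shows "linext g p = (\<Sum>k\<in>K. qscale (Poly_Mapping.lookup p k) (g k))"
  unfolding linext_def using assms
  by (intro sum.mono_neutral_left) (auto simp: in_keys_iff)

lemma linext_add: "linext g (p + q) = linext g p + linext g q"
proof -
  let ?K = "Poly_Mapping.keys p \<union> Poly_Mapping.keys q"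
  have "linext g r = (\<Sum>k\<in>?K. qscale (Poly_Mapping.lookup r k) (g k))"
    if "Poly_Mapping.keys r \<subseteq> ?K" for r
    using that by (intro linext_superset) auto
  then show ?thesis
    using keys_add[of p q] by (simp add: lookup_add Q.scale_left_distrib sum.distrib)
qed

lemma keys_qscale: "Poly_Mapping.keys (qscale c p) \<subseteq> Poly_Mapping.keys p"
  by (auto simp: in_keys_iff lookup_qscale)

lemma linext_qscale: "linext g (qscale c p) = qscale c (linext g p)"
  using linext_superset[of "Poly_Mapping.keys p" "qscale c p" g] keys_qscale[of c p]
  by (simp add: linext_def lookup_qscale Q.scale_sum_right)

lemma linext_0 [simp]: "linext g 0 = 0"
  by (simp add: linext_def)

lemma linext_diff: "linext g (p - q) = linext g p - linext g q"
  using linext_add[of g "p - q" q] by (simp add: algebra_simps)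

lemma linext_basis [simp]: "linext g (basis k) = g k"
  by (simp add: linext_def basis_def)

lemma qscale_basis: "qscale c (basis k) = Poly_Mapping.single k c"
  by (rule poly_mapping_eqI) (simp add: lookup_qscale basis_def lookup_single when_def)

lemma linext_cong:
  "(\<And>k. k \<in> Poly_Mapping.keys p \<Longrightarrow> g k = h k) \<Longrightarrow> linext g p = linext h p"
  by (simp add: linext_def)

lemma linext_basis_ident: "linext basis p = p"
proof (rule poly_mapping_eqI)
  fix k
  have "Poly_Mapping.lookup (linext basis p) k =
      (\<Sum>j\<in>Poly_Mapping.keys p. if j = k then Poly_Mapping.lookup p j else 0)"
    by (auto simp: linext_def lookup_sum qscale_basis lookup_single when_def intro!: sum.cong)
  then show "Poly_Mapping.lookup (linext basis p) k = Poly_Mapping.lookup p k"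
    by (simp add: in_keys_iff)
qed

text \<open>Restricting the middle case to the keys of the given \<open>p\<close> makes hypotheses
  on its support available without carrying them through the induction.\<close>

lemma basis_induct [case_names zero basis add]:
  assumes "P 0" "\<And>c k. k \<in> Poly_Mapping.keys p \<Longrightarrow> P (qscale c (basis k))"
    and "\<And>p q. P p \<Longrightarrow> P q \<Longrightarrow> P (p + q)"
  shows "P p"
proof -
  have "P (\<Sum>k\<in>K. qscale (Poly_Mapping.lookup p k) (basis k))"
    if "finite K" "K \<subseteq> Poly_Mapping.keys p" for K
    using that by (induction K) (auto intro: assms)
  from this[of "Poly_Mapping.keys p"] have "P (linext basis p)" by (simp add: linext_def)
  then show ?thesis by (simp add: linext_basis_ident)
qed

lemma linext_linext: "linext f (linext g p) = linext (\<lambda>k. linext f (g k)) p"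
  by (induction p rule: basis_induct) (simp_all add: linext_add linext_qscale)

lemma keys_linext:
  assumes "\<And>k. k \<in> Poly_Mapping.keys p \<Longrightarrow> Poly_Mapping.keys (g k) \<subseteq> S"
  shows "Poly_Mapping.keys (linext g p) \<subseteq> S"
proof (induction p rule: basis_induct)
  case (basis c k)
  then show ?case using assms[of k] keys_qscale[of c "g k"] by (auto simp: linext_qscale)
next
  case (add p q)
  then show ?case using keys_add[of "linext g p" "linext g q"] by (auto simp: linext_add)
qed simp

lemma qscale_eq_const_mult: "qscale c p = sym_const c * p"
  by (simp add: qscale_def sym_const_def mult_map_scale_conv_mult)

lemma basis_add: "basis (M + N) = basis M * basis N"
  by (simp add: basis_def mult_single)

text \<open>Both sides are bilinear in \<open>p\<close> and \<open>q\<close>, so it suffices to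
  compare them on monomials.\<close>

lemma linext_mult:
  fixes g :: "'a multiset \<Rightarrow> ('b multiset \<Rightarrow>\<^sub>0 rat)"
  assumes "\<And>M N. g (M + N) = g M * g N"
  shows "linext g (p * q) = linext g p * linext g q"
proof (induction p rule: basis_induct)
  case (basis c M)
  have "linext g (basis M * q) = g M * linext g q"
  proof (induction q rule: basis_induct)
    case (basis d N)
    have "basis M * qscale d (basis N) = qscale d (basis (M + N))"
      by (simp add: basis_add qscale_eq_const_mult ac_simps)
    then show ?case by (simp add: linext_qscale assms) (simp add: qscale_eq_const_mult ac_simps)
  qed (simp_all add: linext_add distrib_left)
  moreover have "qscale c (basis M) * q = qscale c (basis M * q)"
    by (simp add: qscale_eq_const_mult ac_simps)
  ultimately show ?case by (simp add: linext_qscale) (simp add: qscale_eq_const_mult ac_simps)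
qed (simp_all add: linext_add distrib_right)

text \<open>Turns spans into support conditions, the form in which subspaces and graded components
  are compared below.\<close>

lemma span_basis: "Q.span (basis ` S) = {p. Poly_Mapping.keys p \<subseteq> S}"
proof
  show "Q.span (basis ` S) \<subseteq> {p. Poly_Mapping.keys p \<subseteq> S}"
  proof (rule Q.span_minimal)
    show "Q.subspace {p. Poly_Mapping.keys p \<subseteq> S}"
    proof (rule Q.subspaceI)
      fix x y :: "'a \<Rightarrow>\<^sub>0 rat" and c
      assume "x \<in> {p. Poly_Mapping.keys p \<subseteq> S}"
      then show "qscale c x \<in> {p. Poly_Mapping.keys p \<subseteq> S}" using keys_qscale[of c x] by auto
      assume "y \<in> {p. Poly_Mapping.keys p \<subseteq> S}"
      with \<open>x \<in> _\<close> show "x + y \<in> {p. Poly_Mapping.keys p \<subseteq> S}" using keys_add[of x y] by auto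
    qed simp
  qed (auto simp: basis_def)
  show "{p. Poly_Mapping.keys p \<subseteq> S} \<subseteq> Q.span (basis ` S)"
  proof
    fix p :: "'a \<Rightarrow>\<^sub>0 rat" assume p: "p \<in> {p. Poly_Mapping.keys p \<subseteq> S}"
    show "p \<in> Q.span (basis ` S)"
      by (induction p rule: basis_induct)
        (use p in \<open>auto intro: Q.span_zero Q.span_add Q.span_scale Q.span_base\<close>)
  qed
qed

lemma bij_betw_relabel:
  assumes "bij_betw f X Y"
  shows "bij_betw (linext (\<lambda>x. basis (f x))) {p. Poly_Mapping.keys p \<subseteq> X} {p. Poly_Mapping.keys p \<subseteq> Y}"
proof (rule bij_betw_byWitness[where f' = "linext (\<lambda>y. basis (inv_into X f y))"])
  show "\<forall>p\<in>{p. Poly_Mapping.keys p \<subseteq> X}.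
      linext (\<lambda>y. basis (inv_into X f y)) (linext (\<lambda>x. basis (f x)) p) = p"
  proof
    fix p :: "_ \<Rightarrow>\<^sub>0 rat" assume "p \<in> {p. Poly_Mapping.keys p \<subseteq> X}"
    then have "linext (\<lambda>x. basis (inv_into X f (f x))) p = linext basis p"
      using bij_betw_inv_into_left[OF assms] by (intro linext_cong) auto
    then show "linext (\<lambda>y. basis (inv_into X f y)) (linext (\<lambda>x. basis (f x)) p) = p"
      by (simp add: linext_linext linext_basis_ident)
  qed
  show "\<forall>p\<in>{p. Poly_Mapping.keys p \<subseteq> Y}.
      linext (\<lambda>x. basis (f x)) (linext (\<lambda>y. basis (inv_into X f y)) p) = p"
  proof
    fix p :: "_ \<Rightarrow>\<^sub>0 rat" assume "p \<in> {p. Poly_Mapping.keys p \<subseteq> Y}"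
    then have "linext (\<lambda>y. basis (f (inv_into X f y))) p = linext basis p"
      using bij_betw_inv_into_right[OF assms] by (intro linext_cong) auto
    then show "linext (\<lambda>x. basis (f x)) (linext (\<lambda>y. basis (inv_into X f y)) p) = p"
      by (simp add: linext_linext linext_basis_ident)
  qed
  show "linext (\<lambda>x. basis (f x)) ` {p. Poly_Mapping.keys p \<subseteq> X} \<subseteq> {p. Poly_Mapping.keys p \<subseteq> Y}"
    using bij_betwE[OF assms] by (intro image_subsetI CollectI keys_linext) (auto simp: basis_def)
  show "linext (\<lambda>y. basis (inv_into X f y)) ` {p. Poly_Mapping.keys p \<subseteq> Y} \<subseteq> {p. Poly_Mapping.keys p \<subseteq> X}"
    using bij_betwE[OF bij_betw_inv_into[OF assms]]
    by (intro image_subsetI CollectI keys_linext) (auto simp: basis_def)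
qed

section \<open>Direct sums of coordinate subspaces and their linear forms\<close>

text \<open>An external direct sum of coordinate subspaces: \<open>X\<close> lists the basis labels
  allowed in each summand.\<close>

definition family_on :: "('i \<times> 'b) set \<Rightarrow> ('i \<Rightarrow>\<^sub>0 ('b \<Rightarrow>\<^sub>0 rat)) set" where
  "family_on X = {v. \<forall>i. \<forall>l\<in>Poly_Mapping.keys (Poly_Mapping.lookup v i). (i, l) \<in> X}"

definition unit_family :: "'i \<times> 'b \<Rightarrow> ('i \<Rightarrow>\<^sub>0 ('b \<Rightarrow>\<^sub>0 rat))" where
  "unit_family x = Poly_Mapping.single (fst x) (basis (snd x))"

lemma family_on_add:
  assumes "u \<in> family_on X" "v \<in> family_on X"
  shows "u + v \<in> family_on X"
  unfolding family_on_def
proof (intro CollectI allI ballI)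
  fix i l assume "l \<in> Poly_Mapping.keys (Poly_Mapping.lookup (u + v) i)"
  then have "l \<in> Poly_Mapping.keys (Poly_Mapping.lookup u i) \<or> l \<in> Poly_Mapping.keys (Poly_Mapping.lookup v i)"
    using keys_add[of "Poly_Mapping.lookup u i" "Poly_Mapping.lookup v i"] by (auto simp: lookup_add)
  then show "(i, l) \<in> X" using assms by (auto simp: family_on_def)
qed

lemma family_on_dscale: "v \<in> family_on X \<Longrightarrow> dscale c v \<in> family_on X"
  by (auto simp: family_on_def lookup_dscale dest!: keys_qscale[THEN subsetD])

lemma family_on_zero: "0 \<in> family_on X"
  by (simp add: family_on_def)

lemma unit_family_in_family_on: "x \<in> X \<Longrightarrow> unit_family x \<in> family_on X"
  by (auto simp: family_on_def unit_family_def lookup_single when_def basis_def split: if_splits)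

text \<open>The vectors \<open>unit_family x\<close> span: split \<open>v\<close> into its entries,
  then each entry into basis vectors.\<close>

lemma family_induct [consumes 1, case_names zero unit add]:
  assumes v: "v \<in> family_on X" and zero: "P 0"
    and unit: "\<And>c x. x \<in> X \<Longrightarrow> P (dscale c (unit_family x))"
    and add: "\<And>u v. P u \<Longrightarrow> P v \<Longrightarrow> P (u + v)"
  shows "P v"
proof -
  have single: "P (Poly_Mapping.single i w)"
    if "\<And>l. l \<in> Poly_Mapping.keys w \<Longrightarrow> (i, l) \<in> X" for i and w :: "'b \<Rightarrow>\<^sub>0 rat"
  proof (induction w rule: basis_induct)
    case (basis c l)
    have "Poly_Mapping.single i (qscale c (basis l)) = dscale c (unit_family (i, l))"
      by (rule poly_mapping_eqI) (simp add: lookup_dscale unit_family_def lookup_single when_def)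
    then show ?case using unit[of "(i, l)" c] that[OF basis] by simp
  qed (simp_all add: zero single_add add)
  have "P (\<Sum>i\<in>K. Poly_Mapping.single i (Poly_Mapping.lookup v i))" if "finite K" for K
    using that
  proof (induction K)
    case (insert i K)
    have "P (Poly_Mapping.single i (Poly_Mapping.lookup v i))"
      using v by (intro single) (auto simp: family_on_def)
    then show ?case using insert add by simp
  qed (simp add: zero)
  moreover have "(\<Sum>i\<in>Poly_Mapping.keys v. Poly_Mapping.single i (Poly_Mapping.lookup v i)) = v"
    by (rule poly_mapping_eqI) (simp add: lookup_sum lookup_single when_def in_keys_iff)
  ultimately show ?thesis by (metis finite_keys)
qed

text \<open>The coordinates of \<open>v\<close>, read as a linear polynomial with one variable per
  basis label.\<close>

definition lin_form :: "('i \<Rightarrow>\<^sub>0 ('b \<Rightarrow>\<^sub>0 rat)) \<Rightarrow> (('i \<times> 'b) multiset \<Rightarrow>\<^sub>0 rat)" where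
  "lin_form v = (\<Sum>i\<in>Poly_Mapping.keys v.
     linext (\<lambda>l. sym_var (i, l)) (Poly_Mapping.lookup v i))"

lemma lin_form_superset:
  assumes "finite K" "Poly_Mapping.keys v \<subseteq> K"
  shows "lin_form v = (\<Sum>i\<in>K. linext (\<lambda>l. sym_var (i, l)) (Poly_Mapping.lookup v i))"
  unfolding lin_form_def using assms
  by (intro sum.mono_neutral_left) (auto simp: in_keys_iff)

lemma lin_form_add: "lin_form (u + v) = lin_form u + lin_form v"
proof -
  let ?K = "Poly_Mapping.keys u \<union> Poly_Mapping.keys v"
  have "lin_form w = (\<Sum>i\<in>?K. linext (\<lambda>l. sym_var (i, l)) (Poly_Mapping.lookup w i))"
    if "Poly_Mapping.keys w \<subseteq> ?K" for w :: "'a \<Rightarrow>\<^sub>0 ('b \<Rightarrow>\<^sub>0 rat)"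
    using that by (intro lin_form_superset) auto
  then show ?thesis
    using keys_add[of u v] by (simp add: lookup_add linext_add sum.distrib)
qed

lemma lin_form_dscale: "lin_form (dscale c v) = qscale c (lin_form v)"
proof -
  have "Poly_Mapping.keys (dscale c v) \<subseteq> Poly_Mapping.keys v"
    by (auto simp: in_keys_iff lookup_dscale)
  then show ?thesis
    using lin_form_superset[of "Poly_Mapping.keys v" "dscale c v"]
    by (simp add: lin_form_def lookup_dscale linext_qscale Q.scale_sum_right)
qed

lemma lin_form_unit_family: "lin_form (unit_family x) = sym_var x"
proof -
  have "basis (snd x) \<noteq> 0" by (auto simp: basis_def dest: arg_cong[of _ _ Poly_Mapping.keys])
  then show ?thesis by (simp add: lin_form_def unit_family_def)
qed

lemma lin_form_0 [simp]: "lin_form 0 = 0"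
  by (simp add: lin_form_def)

lemma sym_var_eq_basis: "sym_var v = basis {#v#}"
  by (simp add: sym_var_def basis_def)

lemma basis_empty: "basis {#} = 1"
  by (simp add: basis_def)

lemma basis_add_mset: "basis (add_mset v M) = sym_var v * basis M"
  using basis_add[of "{#v#}" M] by (simp add: sym_var_eq_basis)

lemma keys_lin_form:
  assumes "v \<in> family_on X"
  shows "Poly_Mapping.keys (lin_form v) \<subseteq> {{#x#} | x. x \<in> X}"
  using assms
proof (induction v rule: family_induct)
  case (unit c x)
  have "Poly_Mapping.keys (sym_var x) = {{#x#}}" by (simp add: sym_var_def)
  then have "Poly_Mapping.keys (lin_form (dscale c (unit_family x))) \<subseteq> {{#x#}}"
    using keys_qscale[of c "sym_var x"] by (simp add: lin_form_dscale lin_form_unit_family)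
  then show ?case using unit by blast
next
  case (add u v)
  then show ?case using keys_add[of "lin_form u" "lin_form v"] by (auto simp: lin_form_add)
qed simp

section \<open>Substitutions between the two polynomial rings\<close>

text \<open>The substitution of its coordinate form for the variable of each vector.\<close>

definition eval_forms ::
  "(('i \<Rightarrow>\<^sub>0 ('b \<Rightarrow>\<^sub>0 rat)) multiset \<Rightarrow>\<^sub>0 rat) \<Rightarrow> (('i \<times> 'b) multiset \<Rightarrow>\<^sub>0 rat)" where
  "eval_forms = linext (\<lambda>M. prod_mset (image_mset lin_form M))"

text \<open>The substitution in the other direction, sending a coordinate to the variable of the
  corresponding unit vector. On the vectors of \<open>family_on X\<close> the two become mutually
  inverse modulo the relations of the symmetric algebra.\<close>

definition unit_monomials ::
  "(('i \<times> 'b) multiset \<Rightarrow>\<^sub>0 rat) \<Rightarrow> (('i \<Rightarrow>\<^sub>0 ('b \<Rightarrow>\<^sub>0 rat)) multiset \<Rightarrow>\<^sub>0 rat)" where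
  "unit_monomials = linext (\<lambda>N. basis (image_mset unit_family N))"

lemma eval_forms_simps [simp]:
  "eval_forms 0 = 0" "eval_forms (p + q) = eval_forms p + eval_forms q"
  "eval_forms (p - q) = eval_forms p - eval_forms q"
  "eval_forms (qscale c p) = qscale c (eval_forms p)"
  by (simp_all add: eval_forms_def linext_add linext_diff linext_qscale)

lemma unit_monomials_simps [simp]:
  "unit_monomials 0 = 0" "unit_monomials (p + q) = unit_monomials p + unit_monomials q"
  "unit_monomials (qscale c p) = qscale c (unit_monomials p)"
  by (simp_all add: unit_monomials_def linext_add linext_qscale)

lemma unit_monomials_basis [simp]: "unit_monomials (basis N) = basis (image_mset unit_family N)"
  by (simp add: unit_monomials_def)

lemma eval_forms_mult: "eval_forms (p * q) = eval_forms p * eval_forms q"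
  unfolding eval_forms_def by (rule linext_mult) simp

lemma eval_forms_sym_var [simp]: "eval_forms (sym_var v) = lin_form v"
  by (simp add: eval_forms_def sym_var_eq_basis)

lemma eval_forms_basis: "eval_forms (basis M) = prod_mset (image_mset lin_form M)"
  by (simp add: eval_forms_def)

lemma unit_monomials_mult: "unit_monomials (p * q) = unit_monomials p * unit_monomials q"
  unfolding unit_monomials_def by (rule linext_mult) (simp add: basis_add)

text \<open>This composite is the identity on the nose, because the coordinate form of a unit vector
  is a single variable.\<close>

lemma eval_forms_unit_monomials:
  fixes q :: "('i \<times> 'b) multiset \<Rightarrow>\<^sub>0 rat"
  shows "eval_forms (unit_monomials q) = q"
proof -
  have "prod_mset (image_mset lin_form (image_mset unit_family N)) = basis N" for N :: "('i \<times> 'b) multiset"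
    by (induction N) (simp_all add: lin_form_unit_family basis_add_mset basis_empty)
  then show ?thesis
    by (simp add: eval_forms_def unit_monomials_def linext_linext linext_basis_ident)
qed

text \<open>A factor of degree \<open>e\<close> contributes one variable of degree \<open>e\<close>
  to every monomial of the expanded product, so degrees add up. The degree is stored next to the
  vector because the zero vector has none of its own.\<close>

lemma keys_prod_lin_form:
  fixes dg :: "'i \<times> 'b \<Rightarrow> 'd::comm_monoid_add"
  assumes "\<forall>(e, v)\<in>#N. v \<in> family_on {x \<in> X. dg x = e}"
  shows "Poly_Mapping.keys (prod_mset (image_mset lin_form (image_mset snd N))) \<subseteq>
    {M. set_mset M \<subseteq> X \<and> (\<Sum>x\<in>#M. dg x) = (\<Sum>(e, v)\<in>#N. e)}"
  using assms
proof (induction N)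
  case (add ev N)
  obtain e v where ev: "ev = (e, v)" by fastforce
  have "Poly_Mapping.keys (lin_form v) \<subseteq> {{#x#} | x. x \<in> {x \<in> X. dg x = e}}"
    using add.prems ev by (intro keys_lin_form) auto
  then have v: "\<exists>x. M = {#x#} \<and> x \<in> X \<and> dg x = e" if "M \<in> Poly_Mapping.keys (lin_form v)" for M
    using that by blast
  let ?q = "prod_mset (image_mset lin_form (image_mset snd N))"
  have N: "set_mset M \<subseteq> X \<and> (\<Sum>x\<in>#M. dg x) = (\<Sum>(e, v)\<in>#N. e)" if "M \<in> Poly_Mapping.keys ?q" for M
    using add that by auto
  show ?case
  proof
    fix M assume "M \<in> Poly_Mapping.keys (prod_mset (image_mset lin_form (image_mset snd (add_mset ev N))))"
    then obtain M1 M2 where "M = M1 + M2" and M: "M1 \<in> Poly_Mapping.keys (lin_form v)" "M2 \<in> Poly_Mapping.keys ?q"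
      using keys_mult[of "lin_form v" ?q] by (auto simp: ev)
    then show "M \<in> {M. set_mset M \<subseteq> X \<and> (\<Sum>x\<in>#M. dg x) = (\<Sum>(e, v)\<in>#add_mset ev N. e)}"
      using v[OF M(1)] N[OF M(2)] by (auto simp: ev)
  qed
qed simp

lemma keys_eval_forms:
  assumes "p \<in> carrier (poly_on (family_on X))"
  shows "Poly_Mapping.keys (eval_forms p) \<subseteq> {M. set_mset M \<subseteq> X}"
  unfolding eval_forms_def
proof (rule keys_linext)
  fix M assume "M \<in> Poly_Mapping.keys p"
  then have "set_mset M \<subseteq> family_on X" using assms by (simp add: poly_on_simps)
  \<comment> \<open>With the trivial grading the graded statement reduces to the bound on the
    variables.\<close>
  then show "Poly_Mapping.keys (prod_mset (image_mset lin_form M)) \<subseteq> {M. set_mset M \<subseteq> X}"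
    using keys_prod_lin_form[of "image_mset (Pair (0::nat)) M" X "\<lambda>_. 0"]
    by (auto simp: multiset.map_comp comp_def)
qed

lemma keys_unit_monomials:
  assumes "Poly_Mapping.keys q \<subseteq> S"
  shows "Poly_Mapping.keys (unit_monomials q) \<subseteq> image_mset unit_family ` S"
  unfolding unit_monomials_def by (rule keys_linext) (use assms in \<open>auto simp: basis_def\<close>)

section \<open>The symmetric algebra as a polynomial ring in the coordinates\<close>

context
  fixes X :: "('i \<times> 'b) set"
begin

private abbreviation "V \<equiv> family_on X"
private abbreviation "I \<equiv> sym_ideal dscale V"

lemma sym_rels_family_on: "sym_rels dscale V \<subseteq> carrier (poly_on V)"
  by (intro sym_rels_carrier family_on_add family_on_dscale)

lemma ideal_sym_ideal: "ideal I (poly_on V)"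
proof -
  interpret cring "poly_on V" by (rule cring_poly_on)
  show ?thesis unfolding sym_ideal_def by (rule genideal_ideal[OF sym_rels_family_on])
qed

lemma sym_rels_in_sym_ideal: "sym_rels dscale V \<subseteq> I"
proof -
  interpret cring "poly_on V" by (rule cring_poly_on)
  show ?thesis unfolding sym_ideal_def by (rule genideal_self[OF sym_rels_family_on])
qed

lemma sym_ideal_carrier: "p \<in> I \<Longrightarrow> p \<in> carrier (poly_on V)"
  using ideal.Icarr[OF ideal_sym_ideal] .

lemma sym_ideal_zero: "0 \<in> I"
  using additive_subgroup.zero_closed[OF ideal.axioms(1)[OF ideal_sym_ideal]] by (simp add: poly_on_simps)

lemma sym_ideal_add: "p \<in> I \<Longrightarrow> q \<in> I \<Longrightarrow> p + q \<in> I"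
  using additive_subgroup.a_closed[OF ideal.axioms(1)[OF ideal_sym_ideal]] by (simp add: poly_on_simps)

lemma sym_ideal_mult: "p \<in> carrier (poly_on V) \<Longrightarrow> q \<in> I \<Longrightarrow> p * q \<in> I"
  using ideal.I_l_closed[OF ideal_sym_ideal, of q p] by (simp add: poly_on_simps)

lemma sym_const_carrier: "sym_const c \<in> carrier (poly_on V)"
  by (simp add: poly_on_simps sym_const_def)

lemma sym_ideal_qscale: "p \<in> I \<Longrightarrow> qscale c p \<in> I"
  unfolding qscale_eq_const_mult by (intro sym_ideal_mult sym_const_carrier)

lemma sym_ideal_diff: "p \<in> I \<Longrightarrow> q \<in> I \<Longrightarrow> p - q \<in> I"
  using sym_ideal_add[of p "qscale (-1) q"] sym_ideal_qscale[of q "-1"] by simp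

text \<open>Modulo the relations the variable of \<open>v\<close> depends linearly on
  \<open>v\<close>, as does the left term, and on unit vectors the two coincide.\<close>

lemma unit_monomials_lin_form:
  assumes "v \<in> V"
  shows "unit_monomials (lin_form v) - sym_var v \<in> I"
proof -
  \<comment> \<open>Membership in \<open>V\<close> is carried through the induction because
    relations are imposed only on vectors of \<open>V\<close>.\<close>
  have add: "u + v \<in> V \<and> unit_monomials (lin_form (u + v)) - sym_var (u + v) \<in> I"
    if "u \<in> V \<and> unit_monomials (lin_form u) - sym_var u \<in> I"
      "v \<in> V \<and> unit_monomials (lin_form v) - sym_var v \<in> I" for u v
  proof -
    have "sym_var (u + v) - sym_var u - sym_var v \<in> I"
      using sym_rels_in_sym_ideal that by (auto simp: sym_rels_def)
    then have *: "(unit_monomials (lin_form u) - sym_var u) + (unit_monomials (lin_form v) - sym_var v)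
        - (sym_var (u + v) - sym_var u - sym_var v) \<in> I"
      using that by (intro sym_ideal_diff[OF sym_ideal_add]) auto
    have "unit_monomials (lin_form (u + v)) - sym_var (u + v) \<in> I"
      by (rule back_subst[of "\<lambda>p. p \<in> I", OF *]) (simp add: lin_form_add)
    then show ?thesis using that by (simp add: family_on_add)
  qed
  have scale: "dscale c v \<in> V \<and> unit_monomials (lin_form (dscale c v)) - sym_var (dscale c v) \<in> I"
    if "v \<in> V" "unit_monomials (lin_form v) - sym_var v \<in> I" for c v
  proof -
    have "sym_var (dscale c v) - sym_const c * sym_var v \<in> I"
      using sym_rels_in_sym_ideal that by (auto simp: sym_rels_def)
    then have *: "qscale c (unit_monomials (lin_form v) - sym_var v)
        - (sym_var (dscale c v) - sym_const c * sym_var v) \<in> I"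
      using that by (intro sym_ideal_diff[OF sym_ideal_qscale]) auto
    have "unit_monomials (lin_form (dscale c v)) - sym_var (dscale c v) \<in> I"
      by (rule back_subst[of "\<lambda>p. p \<in> I", OF *])
        (simp add: lin_form_dscale Q.scale_right_diff_distrib qscale_eq_const_mult[of c "sym_var v"])
    then show ?thesis using that by (simp add: family_on_dscale)
  qed
  have unit: "unit_family x \<in> V \<and> unit_monomials (lin_form (unit_family x)) - sym_var (unit_family x) \<in> I"
    if "x \<in> X" for x
    using that sym_ideal_zero
    by (simp add: lin_form_unit_family sym_var_eq_basis unit_family_in_family_on)
  \<comment> \<open>The relation for \<open>0 + 0\<close> is the negative of the variable of the
    zero vector.\<close>
  have *: "sym_var (0 + 0) - sym_var 0 - sym_var 0 \<in> I"
    using sym_rels_in_sym_ideal family_on_zero[of X] unfolding sym_rels_def by blast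
  have "unit_monomials (lin_form 0) - sym_var 0 \<in> I"
    by (rule back_subst[of "\<lambda>p. p \<in> I", OF *]) simp
  then have zero: "0 \<in> V \<and> unit_monomials (lin_form 0) - sym_var 0 \<in> I"
    by (simp add: family_on_zero)
  have "v \<in> V \<and> unit_monomials (lin_form v) - sym_var v \<in> I"
    using assms by (induction v rule: family_induct) (use zero unit scale add in blast)+
  then show ?thesis ..
qed

text \<open>Known for variables, this passes to monomials by multiplicativity and to all polynomials
  by linearity.\<close>

lemma unit_monomials_eval_forms:
  assumes p: "p \<in> carrier (poly_on V)"
  shows "unit_monomials (eval_forms p) - p \<in> I"
proof -
  have "unit_monomials (eval_forms (basis M)) - basis M \<in> I" if "set_mset M \<subseteq> V" for M
    using that
  proof (induction M)
    case empty
    then show ?case using sym_ideal_zero by (simp add: eval_forms_basis flip: basis_empty)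
  next
    case (add v M)
    let ?r = "\<lambda>p. unit_monomials (eval_forms p)"
    have "?r (sym_var v) - sym_var v \<in> I" using add.prems by (simp add: unit_monomials_lin_form)
    moreover have "?r (basis M) - basis M \<in> I" using add by simp
    moreover have "basis M \<in> carrier (poly_on V)" "sym_var v \<in> carrier (poly_on V)"
      using add.prems by (simp_all add: poly_on_simps basis_def sym_var_def)
    moreover have "?r (basis M) \<in> carrier (poly_on V)"
      using poly_on_add[OF sym_ideal_carrier[OF calculation(2)] calculation(3)] by simp
    \<comment> \<open>A difference of products lies in the ideal by
      \<open>x' y' - x y = y' (x' - x) + x (y' - y)\<close>.\<close>
    ultimately have *: "?r (basis M) * (?r (sym_var v) - sym_var v)
        + sym_var v * (?r (basis M) - basis M) \<in> I"
      by (intro sym_ideal_add sym_ideal_mult)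
    show ?case
      by (rule back_subst[of "\<lambda>p. p \<in> I", OF *])
        (simp add: basis_add_mset eval_forms_mult unit_monomials_mult algebra_simps)
  qed
  then have "unit_monomials (eval_forms (qscale c (basis M))) - qscale c (basis M) \<in> I"
    if "M \<in> Poly_Mapping.keys p" for c M
    using sym_ideal_qscale[of "unit_monomials (eval_forms (basis M)) - basis M" c] that p
    by (simp add: poly_on_simps Q.scale_right_diff_distrib)
  note monomial = this
  show ?thesis
  proof (induction p rule: basis_induct)
    case (basis c M)
    then show ?case by (rule monomial)
  next
    case (add p q)
    show ?case
      by (rule back_subst[of "\<lambda>p. p \<in> I", OF sym_ideal_add[OF add]]) simp
  qed (simp add: sym_ideal_zero)
qed

text \<open>The kernel of \<open>eval_forms\<close> is an ideal, and it contains the relations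
  because \<open>lin_form\<close> is linear.\<close>

lemma eval_forms_sym_ideal:
  assumes "p \<in> I"
  shows "eval_forms p = 0"
proof -
  interpret cring "poly_on V" by (rule cring_poly_on)
  let ?K = "{p \<in> carrier (poly_on V). eval_forms p = 0}"
  have "ideal ?K (poly_on V)"
  proof (rule idealI)
    show "subgroup ?K (add_monoid (poly_on V))"
    proof (rule add.subgroupI)
      fix a assume "a \<in> ?K"
      moreover have "\<ominus>\<^bsub>poly_on V\<^esub> a = 0 - a" if "a \<in> carrier (poly_on V)"
        by (rule minus_equality) (use that poly_on_diff[OF poly_on_0 that] in \<open>simp_all add: poly_on_simps\<close>)
      ultimately show "\<ominus>\<^bsub>poly_on V\<^esub> a \<in> ?K"
        using poly_on_diff[OF poly_on_0, of a]
        by (auto simp del: diff_0)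
    next
      show "?K \<noteq> {}" using poly_on_0 by force
    qed (auto simp: poly_on_simps(2-) poly_on_add)
  qed (auto simp: poly_on_simps(2-) poly_on_mult eval_forms_mult ring_axioms)
  moreover have "sym_rels dscale V \<subseteq> ?K"
    using sym_rels_family_on
    by (auto simp: sym_rels_def lin_form_add lin_form_dscale simp flip: qscale_eq_const_mult)
  ultimately have "I \<subseteq> ?K" unfolding sym_ideal_def by (rule genideal_minimal)
  then show ?thesis using assms by auto
qed

lemma poly_on_minus:
  assumes "p \<in> carrier (poly_on V)" "q \<in> carrier (poly_on V)"
  shows "p \<ominus>\<^bsub>poly_on V\<^esub> q = p - q"
proof -
  interpret cring "poly_on V" by (rule cring_poly_on)
  have "\<ominus>\<^bsub>poly_on V\<^esub> q = 0 - q"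
    by (rule minus_equality)
      (use assms(2) poly_on_diff[OF poly_on_0 assms(2)] in \<open>simp_all add: poly_on_simps(2-)\<close>)
  then show ?thesis by (simp add: a_minus_def poly_on_simps(2-))
qed

lemma sym_class_eq_iff:
  assumes "p \<in> carrier (poly_on V)" "q \<in> carrier (poly_on V)"
  shows "sym_class dscale V p = sym_class dscale V q \<longleftrightarrow> p - q \<in> I"
proof -
  interpret cring "poly_on V" by (rule cring_poly_on)
  show ?thesis
    using quotient_eq_iff_same_a_r_cos[OF ideal_sym_ideal assms] by (simp add: sym_class_def poly_on_minus assms)
qed

lemma sym_class_hom: "sym_class dscale V \<in> ring_hom (poly_on V) (Sym dscale V)"
  using ideal.rcos_ring_hom[OF ideal_sym_ideal] by (simp add: sym_class_def[abs_def] Sym_def)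

lemma carrier_Sym: "carrier (Sym dscale V) = sym_class dscale V ` carrier (poly_on V)"
  by (auto simp: Sym_def FactRing_def A_RCOSETS_def' sym_class_def)

lemma unit_monomials_carrier:
  assumes "Poly_Mapping.keys q \<subseteq> {N. set_mset N \<subseteq> X}"
  shows "unit_monomials q \<in> carrier (poly_on V)"
  unfolding poly_on_simps
proof
  fix M assume "M \<in> Poly_Mapping.keys (unit_monomials q)"
  then obtain N where "M = image_mset unit_family N" "set_mset N \<subseteq> X"
    using keys_unit_monomials[OF assms] by blast
  then show "set_mset M \<subseteq> V" by (auto intro: unit_family_in_family_on)
qed

lemma sym_class_unit_monomials_eval_forms:
  assumes "p \<in> carrier (poly_on V)"
  shows "sym_class dscale V (unit_monomials (eval_forms p)) = sym_class dscale V p"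
  using assms unit_monomials_eval_forms[OF assms] unit_monomials_carrier[OF keys_eval_forms[OF assms]]
  by (simp add: sym_class_eq_iff)

text \<open>Injective because \<open>eval_forms\<close> vanishes on the ideal and undoes
  \<open>unit_monomials\<close>; surjective because every \<open>p\<close> is congruent to
  \<open>unit_monomials (eval_forms p)\<close>.\<close>

lemma bij_betw_sym_class_unit_monomials:
  "bij_betw (\<lambda>q. sym_class dscale V (unit_monomials q))
    {q. Poly_Mapping.keys q \<subseteq> {N. set_mset N \<subseteq> X}} (carrier (Sym dscale V))"
proof (rule bij_betw_imageI)
  show "inj_on (\<lambda>q. sym_class dscale V (unit_monomials q)) {q. Poly_Mapping.keys q \<subseteq> {N. set_mset N \<subseteq> X}}"
  proof (rule inj_onI, unfold mem_Collect_eq)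
    fix p q assume p: "Poly_Mapping.keys p \<subseteq> {N. set_mset N \<subseteq> X}"
      and q: "Poly_Mapping.keys q \<subseteq> {N. set_mset N \<subseteq> X}"
      and "sym_class dscale V (unit_monomials p) = sym_class dscale V (unit_monomials q)"
    then have "unit_monomials p - unit_monomials q \<in> I"
      using sym_class_eq_iff[OF unit_monomials_carrier[OF p] unit_monomials_carrier[OF q]] by simp
    from eval_forms_sym_ideal[OF this] show "p = q" by (simp add: eval_forms_unit_monomials)
  qed
  show "(\<lambda>q. sym_class dscale V (unit_monomials q)) ` {q. Poly_Mapping.keys q \<subseteq> {N. set_mset N \<subseteq> X}} =
    carrier (Sym dscale V)"
  proof (intro equalityI subsetI)
    fix c assume "c \<in> carrier (Sym dscale V)"
    then obtain p where p: "p \<in> carrier (poly_on V)" "c = sym_class dscale V p"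
      by (auto simp: carrier_Sym)
    then have "c = sym_class dscale V (unit_monomials (eval_forms p))"
      by (simp add: sym_class_unit_monomials_eval_forms)
    then show "c \<in> (\<lambda>q. sym_class dscale V (unit_monomials q)) ` {q. Poly_Mapping.keys q \<subseteq> {N. set_mset N \<subseteq> X}}"
      using keys_eval_forms[OF p(1)] by blast
  next
    fix c assume "c \<in> (\<lambda>q. sym_class dscale V (unit_monomials q)) ` {q. Poly_Mapping.keys q \<subseteq> {N. set_mset N \<subseteq> X}}"
    then obtain q where "Poly_Mapping.keys q \<subseteq> {N. set_mset N \<subseteq> X}"
      and "c = sym_class dscale V (unit_monomials q)"
      by blast
    then show "c \<in> carrier (Sym dscale V)"
      unfolding carrier_Sym by (blast intro: unit_monomials_carrier)
  qed
qed

section \<open>The grading of the symmetric algebra\<close>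

text \<open>A product of homogeneous vectors of total degree \<open>d\<close> expands under
  \<open>eval_forms\<close> into monomials of degree \<open>d\<close>. Conversely, a monomial in the
  coordinates becomes a product of unit vectors, each homogeneous of the degree of its
  label.\<close>

lemma Sym_comp_eq:
  fixes dg :: "'i \<times> 'b \<Rightarrow> 'd::comm_monoid_add"
  shows "Sym_comp dscale V (\<lambda>e. family_on {x \<in> X. dg x = e}) d =
    (\<lambda>q. sym_class dscale V (unit_monomials q)) `
      {q. Poly_Mapping.keys q \<subseteq> {N. set_mset N \<subseteq> X \<and> (\<Sum>x\<in>#N. dg x) = d}}"
proof -
  define grd where "grd = (\<lambda>e. family_on {x \<in> X. dg x = e})"
  define Mons where "Mons = {image_mset snd N | N. (\<forall>(e, v)\<in>#N. v \<in> grd e) \<and> (\<Sum>(e, v)\<in>#N. e) = d}"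
  have "sym_monomials grd d = basis ` Mons" by (auto simp: sym_monomials_def Mons_def)
  then have span: "Q.span (sym_monomials grd d) = {p. Poly_Mapping.keys p \<subseteq> Mons}"
    by (simp add: span_basis)
  have grd: "grd e \<subseteq> V" for e by (auto simp: grd_def family_on_def)
  have Mons_V: "set_mset M \<subseteq> V" if "M \<in> Mons" for M
    using that grd by (fastforce simp: Mons_def)
  have "sym_class dscale V ` {p. Poly_Mapping.keys p \<subseteq> Mons} =
    (\<lambda>q. sym_class dscale V (unit_monomials q)) `
      {q. Poly_Mapping.keys q \<subseteq> {N. set_mset N \<subseteq> X \<and> (\<Sum>x\<in>#N. dg x) = d}}"
  proof (intro equalityI image_subsetI)
    fix p :: "_ \<Rightarrow>\<^sub>0 rat" assume p: "p \<in> {p. Poly_Mapping.keys p \<subseteq> Mons}"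
    then have carr: "p \<in> carrier (poly_on V)" using Mons_V by (fastforce simp: poly_on_simps)
    have "Poly_Mapping.keys (eval_forms p) \<subseteq> {N. set_mset N \<subseteq> X \<and> (\<Sum>x\<in>#N. dg x) = d}"
      unfolding eval_forms_def
    proof (rule keys_linext)
      fix M assume "M \<in> Poly_Mapping.keys p"
      then have "M \<in> Mons" using p by auto
      then obtain N where N: "M = image_mset snd N" "\<forall>(e, v)\<in>#N. v \<in> grd e" "(\<Sum>(e, v)\<in>#N. e) = d"
        by (auto simp: Mons_def)
      show "Poly_Mapping.keys (prod_mset (image_mset lin_form M)) \<subseteq>
          {N. set_mset N \<subseteq> X \<and> (\<Sum>x\<in>#N. dg x) = d}"
        using keys_prod_lin_form[of N X dg] N by (simp add: grd_def)
    qed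
    then show "sym_class dscale V p \<in> (\<lambda>q. sym_class dscale V (unit_monomials q)) `
        {q. Poly_Mapping.keys q \<subseteq> {N. set_mset N \<subseteq> X \<and> (\<Sum>x\<in>#N. dg x) = d}}"
      using sym_class_unit_monomials_eval_forms[OF carr] by (intro image_eqI[of _ _ "eval_forms p"]) auto
  next
    fix q :: "('i \<times> 'b) multiset \<Rightarrow>\<^sub>0 rat"
    assume "q \<in> {q. Poly_Mapping.keys q \<subseteq> {N. set_mset N \<subseteq> X \<and> (\<Sum>x\<in>#N. dg x) = d}}"
    then have "Poly_Mapping.keys (unit_monomials q) \<subseteq>
        image_mset unit_family ` {N. set_mset N \<subseteq> X \<and> (\<Sum>x\<in>#N. dg x) = d}"
      by (intro keys_unit_monomials) simp
    also have "\<dots> \<subseteq> Mons"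
    proof (rule image_subsetI)
      fix N assume N: "N \<in> {N. set_mset N \<subseteq> X \<and> (\<Sum>x\<in>#N. dg x) = d}"
      define N' where "N' = image_mset (\<lambda>x. (dg x, unit_family x)) N"
      have "image_mset unit_family N = image_mset snd N'" "(\<Sum>(e, v)\<in>#N'. e) = d"
        using N by (simp_all add: N'_def multiset.map_comp comp_def)
      moreover have "\<forall>(e, v)\<in>#N'. v \<in> grd e"
        using N by (auto simp: N'_def grd_def intro!: unit_family_in_family_on)
      ultimately show "image_mset unit_family N \<in> Mons" unfolding Mons_def by blast
    qed
    finally show "sym_class dscale V (unit_monomials q) \<in> sym_class dscale V ` {p. Poly_Mapping.keys p \<subseteq> Mons}"
      by blast
  qed
  then show ?thesis unfolding Sym_comp_def grd_def[symmetric] span .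
qed

text \<open>The bijection \<open>K\<close> relabels the basis by monomials, and these represent a
  basis of the symmetric algebra. As \<open>K\<close> preserves degrees, components match.\<close>

lemma bigraded_iso_Sym:
  fixes dg :: "'i \<times> 'b \<Rightarrow> nat \<times> int" and K :: "'s \<Rightarrow> ('i \<times> 'b) multiset"
  assumes K: "bij_betw K S {N. set_mset N \<subseteq> X}"
    and dg: "\<And>s. s \<in> S \<Longrightarrow> (\<Sum>x\<in>#K s. dg x) = dS s"
  shows "bigraded_iso
    {p. Poly_Mapping.keys p \<subseteq> S} (+) qscale (\<lambda>d. {p. Poly_Mapping.keys p \<subseteq> {s \<in> S. dS s = d}})
    (carrier (Sym dscale V)) (add (Sym dscale V)) (sym_scale dscale V)
    (Sym_comp dscale V (\<lambda>e. family_on {x \<in> X. dg x = e}))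
    (\<lambda>p. sym_class dscale V (unit_monomials (linext (\<lambda>s. basis (K s)) p)))"
  unfolding bigraded_iso_def
proof (intro conjI ballI allI)
  let ?K = "linext (\<lambda>s. basis (K s))"
  let ?c = "\<lambda>q. sym_class dscale V (unit_monomials q)"
  note bij = bij_betw_relabel[OF K]
  show "bij_betw (\<lambda>p. ?c (?K p)) {p. Poly_Mapping.keys p \<subseteq> S} (carrier (Sym dscale V))"
    using bij_betw_trans[OF bij bij_betw_sym_class_unit_monomials] by (simp add: comp_def)
  have carr: "unit_monomials (?K p) \<in> carrier (poly_on V)" if "p \<in> {p. Poly_Mapping.keys p \<subseteq> S}" for p
    using bij_betwE[OF bij] that by (intro unit_monomials_carrier) blast
  show "?c (?K (p + q)) = ?c (?K p) \<oplus>\<^bsub>Sym dscale V\<^esub> ?c (?K q)"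
    if "p \<in> {p. Poly_Mapping.keys p \<subseteq> S}" "q \<in> {p. Poly_Mapping.keys p \<subseteq> S}" for p q
    using ring_hom_add[OF sym_class_hom carr[OF that(1)] carr[OF that(2)]]
    by (simp add: linext_add poly_on_simps)
  show "?c (?K (qscale c p)) = sym_scale dscale V c (?c (?K p))"
    if "p \<in> {p. Poly_Mapping.keys p \<subseteq> S}" for c p
    using ring_hom_mult[OF sym_class_hom sym_const_carrier carr[OF that]]
    by (simp add: linext_qscale poly_on_simps sym_scale_def)
      (simp add: qscale_eq_const_mult)
  fix d
  have "bij_betw K {s \<in> S. dS s = d} {N. set_mset N \<subseteq> X \<and> (\<Sum>x\<in>#N. dg x) = d}"
  proof (rule bij_betw_subset[OF K])
    show "K ` {s \<in> S. dS s = d} = {N. set_mset N \<subseteq> X \<and> (\<Sum>x\<in>#N. dg x) = d}"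
    proof (intro equalityI subsetI)
      fix N assume N: "N \<in> {N. set_mset N \<subseteq> X \<and> (\<Sum>x\<in>#N. dg x) = d}"
      then obtain s where "s \<in> S" "N = K s" using bij_betw_imp_surj_on[OF K] by blast
      then show "N \<in> K ` {s \<in> S. dS s = d}" using N dg by auto
    qed (use bij_betwE[OF K] dg in auto)
  qed auto
  note surj = bij_betw_imp_surj_on[OF bij_betw_relabel[OF this]]
  show "(\<lambda>p. ?c (?K p)) ` {p. Poly_Mapping.keys p \<subseteq> {s \<in> S. dS s = d}} =
      Sym_comp dscale V (\<lambda>e. family_on {x \<in> X. dg x = e}) d"
    unfolding Sym_comp_eq surj[symmetric] by (simp only: image_image)
qed

end

section \<open>The isomorphism\<close>

lemma A_eq: "A = {p. Poly_Mapping.keys p \<subseteq> partitions}"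
  by (simp add: A_def span_basis)

lemma A_comp_eq: "A_comp m d = {p. Poly_Mapping.keys p \<subseteq> {l \<in> partitions. deg m l = d}}"
  by (simp add: A_comp_def span_basis deg_def)

lemma shift_op_funpow: "shift_op ^^ i = linext (\<lambda>l. basis (shift_part i l))"
proof (induction i)
  case 0
  show ?case by (rule ext) (simp add: linext_basis_ident)
next
  case (Suc i)
  have *: "shift_op p = linext (\<lambda>l. basis (shift_part 1 l)) p" for p
    by (simp add: shift_op_def linext_def)
  show ?case
    unfolding funpow.simps Suc.IH by (rule ext) (simp add: * linext_linext shift_part_shift_part)
qed

lemma SBL_eq: "SBL m i = {p. Poly_Mapping.keys p \<subseteq> shift_part i ` TL m}"
proof -
  have "bij_betw (shift_part i) (TL m) (shift_part i ` TL m)"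
    by (intro inj_on_imp_bij_betw inj_on_subset[OF inj_shift_part]) simp
  from bij_betw_imp_surj_on[OF bij_betw_relabel[OF this]] show ?thesis
    by (simp add: SBL_def BL_def span_basis shift_op_funpow)
qed

lemma SBL_sum_eq: "SBL_sum m = family_on (gens m)"
  by (auto simp: SBL_sum_def direct_sum_def SBL_eq family_on_def gens_def)

lemma TL_subset_T_all: "TL m \<subseteq> T_all m"
proof
  fix t assume "t \<in> TL m"
  then obtain w where "w \<in> lyndon_words m" "t = star_word m w"
    using bij_betw_imp_surj_on[OF bij_betw_star_word_TL] by blast
  then show "t \<in> T_all m" using star_word_in_T_all[of w m] by (simp add: lyndon_words_def lists_eq_set)
qed

lemma SBL_comp_eq: "SBL_comp m i d = {p. Poly_Mapping.keys p \<subseteq> {l \<in> shift_part i ` TL m. deg m l = d}}"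
proof -
  have "shift_part i ` TL m \<subseteq> partitions"
    using TL_subset_T_all[of m] T_all_sorted by (auto simp: partitions_def subset_eq)
  then show ?thesis unfolding SBL_comp_def SBL_eq A_comp_eq by blast
qed

lemma SBL_sum_comp_eq: "SBL_sum_comp m d = family_on {x \<in> gens m. deg m (snd x) = d}"
  unfolding SBL_sum_comp_def SBL_comp_eq direct_sum_def family_on_def gens_def by auto

theorem theorem5p9:
  fixes m :: nat
  assumes "m \<ge> 1"
  shows "\<exists>\<phi>. bigraded_iso
           A (+) qscale (A_comp m)
           (carrier (Sym dscale (SBL_sum m))) (add (Sym dscale (SBL_sum m)))
           (sym_scale dscale (SBL_sum m))
           (Sym_comp dscale (SBL_sum m) (SBL_sum_comp m)) \<phi>"
proof -
  obtain K where K: "bij_betw K partitions {N. set_mset N \<subseteq> gens m}"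
    and deg_K: "\<And>l. l \<in> partitions \<Longrightarrow> (\<Sum>(i, t)\<in>#K l. deg m t) = deg m l"
    using partitions_multisets_bij[OF assms] by blast
  have "(\<Sum>x\<in>#K l. deg m (snd x)) = deg m l" if "l \<in> partitions" for l
    using deg_K[OF that] by (simp add: case_prod_unfold)
  \<comment> \<open>Written by supports, both spaces and their components have the form required for
    \<open>X = gens m\<close>, each label being graded by its partition.\<close>
  from bigraded_iso_Sym[OF K this] show ?thesis
    unfolding A_eq SBL_sum_eq A_comp_eq[abs_def] SBL_sum_comp_eq[abs_def] by blast
qed

end
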